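(* The two-point functions $F_{\hat n,\hat m}$ ($n,m\ge0$) of the extended dispersionless Toda hierarchy, evaluated where $F_{00}=0$ and $F_{01}=0$, are given (using the symmetry $F_{\hat n,\hat m}=F_{\hat m,\hat n}$) by $$F_{\widehat{2k},\hat0}=-\frac{k+1}{2}d_kC_k,\qquad k=1,2,\dots,$$ $$F_{\widehat{2k+1},\widehat{2l+1}}=\frac{(2l+1)(2k+1)(l+1)(k+1)}{l+k+1}\left[\left(d_k+\frac{1}{2(l+k+1)}\right)\left(d_l+\frac{1}{2(l+k+1)}\right)+\frac{1}{4(k+l+1)^2}\right]C_kC_l,\qquad k,l=0,1,2,\dots,$$ $$F_{\widehat{2k},\widehat{2l}}=\frac{lk(l+1)(k+1)}{l+k}\left[\left(d_k-\frac{l}{2k(l+k)}\right)\left(d_l-\frac{k}{2l(l+k)}\right)+\frac{1}{4(k+l)^2}\right]C_kC_l,\qquad k,l=1,2,\dots,$$ and $F_{\hat n,\hat m}=0$ otherwise. Here $C_k=\frac1{k+1}\binom{2k}{k}$ is the $k$-th Catalan number.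
   Context: Extended dispersionless Toda (dToda) hierarchy. Let $L=p+u_1+u_2p^{-1}$, where $u_1,u_2$ are functions of $t_0$, $t=(t_1,t_2,\dots)$ and $\hat t=(\hat t_1,\hat t_2,\dots)$. For a series $A=\sum_k a_kp^k$ put $A_{\ge 0}=\sum_{k\ge0}a_kp^k$, $A_{\le -1}=A-A_{\ge 0}$. The Poisson bracket is $\{A,B\}=p\,\partial_pA\,\partial_{t_0}B-p\,\partial_{t_0}A\,\partial_pB$. Put $d_n=\sum_{j=1}^n 1/j$, $d_0=0$, and $$\log L=\tfrac12\log u_2+\tfrac12\log(1+u_1p^{-1}+u_2p^{-2})+\tfrac12\log\left(1+\tfrac{u_1}{u_2}p+\tfrac1{u_2}p^2\right),$$ where the second term is Taylor expanded in $p^{-1}$ and the third in $p$. The hierarchy is $$\partial_{t_n}L=\{B_n,L\},\ B_n=(L^n)_{\ge0}\ (n\ge1);\qquad \partial_{\hat t_n}L=\{\hat B_n,L\},\ \hat B_n=\left(L^n(\log L-d_n)\right)_{\ge0}\ (n\ge0),$$ with $\hat t_0=2t_0$, i.e. $\partial_{\hat t_0}=\frac12\partial_{t_0}$. Free energy. $F(t_0,t,\hat t)$ is a function whose derivatives are denoted by subscripts: index $0$ is $\partial_{t_0}$, index $n\ge1$ is $\partial_{t_n}$, index $\hat n$ ($n\ge 0$) is $\partial_{\hat t_n}$ (so $F_{\hat 0,X}=\frac12F_{0,X}$ for any index $X$); e.g. $F_{n,m}=\partial_{t_n}\partial_{t_m}F$, $F_{\hat n,\hat m}=\partial_{\hat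 t_n}\partial_{\hat t_m}F$. It is related to $L$ by $F_{00}=\log u_2$ and the following expansions in negative powers of $L$ (each $L^{-m}$ expanded in powers of $p^{-1}$): $$\log(1+u_1p^{-1}+u_2p^{-2})=\sum_{m\ge1}\frac{F_{0m}}{m}L^{-m},\quad (L^n)_{\le-1}=\sum_{m\ge1}\frac{F_{nm}}{m}L^{-m}\ (n\ge 1),\quad \left(L^n(\log L-d_n)\right)_{\le-1}=\sum_{m\ge1}\frac{F_{\hat nm}}{m}L^{-m}\ (n\ge0).$$ In particular $u_1=F_{01}$ and $u_2=F_{11}=e^{F_{00}}$. Integration convention. These relations leave constants of $t_0$-integration in $F_{\hat n0}$ and $F_{\hat n\hat m}$; all $t_0$-integrations are made without adding constants: if $A,B$ are polynomials without constant term in the second derivatives of $F$ and $\partial_{t_0}A=\partial_{t_0}B$, then $A=B$. The two-point functions in the claim are evaluated at a point of the time variables where $F_{00}=F_{01}=0$ (equivalently $u_1=0$, $u_2=1$). *)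

theory Defs
  imports
    "HOL-Analysis.Analysis"
    "HOL-Computational_Algebra.Computational_Algebra"
begin

section \<open>Time variables and partial derivatives\<close>

text \<open>
  \<open>T n\<close> stands for \<open>t\<^sub>n\<close> (\<open>n \<ge> 0\<close>) and \<open>That n\<close> for the hatted time of index \<open>n\<close>.  A point assigns
  a value to every time.  The hatted time of index 0 is not an independent variable but equals
  \<open>2 t\<^sub>0\<close>: moving it by \<open>s\<close> moves \<open>t\<^sub>0\<close> by \<open>s / 2\<close>, and the coordinate \<open>x (That 0)\<close> of a point is
  never used.  The scalars range over any complete normed field, so both real and complex times
  are covered.
\<close>

datatype time = T nat | That nat

type_synonym 'a point = "time \<Rightarrow> 'a"

definition shift :: "time \<Rightarrow> 'a::field \<Rightarrow> 'a point \<Rightarrow> 'a point" where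
  "shift i s x =
     (if i = That 0 then x(T 0 := x (T 0) + s / 2) else x(i := x i + s))"

definition pd :: "time \<Rightarrow> ('a::real_normed_field point \<Rightarrow> 'a) \<Rightarrow> 'a point \<Rightarrow> 'a" where
  "pd i f x = deriv (\<lambda>s. f (shift i s x)) 0"

primrec pds :: "time list \<Rightarrow> ('a::real_normed_field point \<Rightarrow> 'a) \<Rightarrow> 'a point \<Rightarrow> 'a" where
  "pds [] f = f"
| "pds (i # is) f = pd i (pds is f)"

text \<open>
  Only openness along the coordinate lines is required of the domain of the times, and of the
  smoothness of a function only that partial derivatives of all orders exist and that their order
  is immaterial.
\<close>

definition time_domain :: "'a::real_normed_field point set \<Rightarrow> bool" where
  "time_domain D \<longleftrightarrow> (\<forall>x\<in>D. \<forall>i. \<forall>\<^sub>F s in nhds 0. shift i s x \<in> D)"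

definition smooth_fun :: "'a::real_normed_field point set \<Rightarrow> ('a point \<Rightarrow> 'a) \<Rightarrow> bool" where
  "smooth_fun D f \<longleftrightarrow>
     (\<forall>is i j. \<forall>x\<in>D.
        (\<lambda>s. pds is f (shift i s x)) field_differentiable (at 0) \<and>
        pd i (pd j (pds is f)) x = pd j (pd i (pds is f)) x)"


section \<open>Formal series in p\<close>

text \<open>
  A series \<open>\<Sum>\<^sub>k a\<^sub>k p\<^sup>k\<close>, possibly infinite in both directions, is the function \<open>k \<mapsto> a\<^sub>k\<close>.  The product
  is meaningful only if every coefficient is a finite sum; this is the case throughout, as one
  of the factors is always a Laurent polynomial.
\<close>

type_synonym 'a series = "int \<Rightarrow> 'a"

definition times_series :: "'a::field series \<Rightarrow> 'a series \<Rightarrow> 'a series" where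
  "times_series A B k = (\<Sum>j | A j \<noteq> 0 \<and> B (k - j) \<noteq> 0. A j * B (k - j))"

definition nonneg_part :: "'a::zero series \<Rightarrow> 'a series" where
  "nonneg_part A k = (if k \<ge> 0 then A k else 0)"

definition neg_part :: "'a::zero series \<Rightarrow> 'a series" where
  "neg_part A k = (if k \<le> -1 then A k else 0)"

definition p_dp :: "'a::field series \<Rightarrow> 'a series" where
  "p_dp A k = of_int k * A k"

definition d_time :: "time \<Rightarrow> ('a::real_normed_field point \<Rightarrow> 'a series) \<Rightarrow> 'a point \<Rightarrow> 'a series"
  where "d_time i A x k = pd i (\<lambda>y. A y k) x"

definition poisson ::
  "('a::real_normed_field point \<Rightarrow> 'a series) \<Rightarrow> ('a point \<Rightarrow> 'a series) \<Rightarrow> 'a point \<Rightarrow> 'a series"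
  where "poisson A B x k =
     times_series (p_dp (A x)) (d_time (T 0) B x) k - times_series (d_time (T 0) A x) (p_dp (B x)) k"


section \<open>The Lax function, its powers and its logarithm\<close>

text \<open>
  \<open>p + u\<^sub>1 + u\<^sub>2 p\<^sup>-\<^sup>1\<close> as a formal Laurent series in the variable \<open>p\<^sup>-\<^sup>1\<close>.  Its integer powers, positive
  or negative, are thus expanded in powers of \<open>p\<^sup>-\<^sup>1\<close>.
\<close>

definition Lax_fls :: "'a::field \<Rightarrow> 'a \<Rightarrow> 'a fls" where
  "Lax_fls u1 u2 = fls_X_inv + fls_const u1 + fls_const u2 * fls_X"

definition Lax_pow :: "'a::field \<Rightarrow> 'a \<Rightarrow> int \<Rightarrow> 'a series" where
  "Lax_pow u1 u2 n k = fls_nth (Lax_fls u1 u2 powi n) (- k)"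

abbreviation Lax :: "'a::field \<Rightarrow> 'a \<Rightarrow> 'a series" where
  "Lax u1 u2 \<equiv> Lax_pow u1 u2 1"

text \<open>
  \<open>log (1 + a X + b X\<^sup>2)\<close>, Taylor expanded in \<open>X\<close>; \<open>fps_ln 1\<close> is the series of \<open>log (1 + X)\<close>.
\<close>

definition log_quad :: "'a::field_char_0 \<Rightarrow> 'a \<Rightarrow> 'a fps" where
  "log_quad a b = fps_compose (fps_ln 1) (fps_const a * fps_X + fps_const b * fps_X ^ 2)"

definition in_p :: "'a::zero fps \<Rightarrow> 'a series" where
  "in_p f k = (if k \<ge> 0 then fps_nth f (nat k) else 0)"

definition in_p_inv :: "'a::zero fps \<Rightarrow> 'a series" where
  "in_p_inv f k = (if k \<le> 0 then fps_nth f (nat (- k)) else 0)"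

definition const_series :: "'a::zero \<Rightarrow> 'a series" where
  "const_series c k = (if k = 0 then c else 0)"

text \<open>
  Here and below \<open>lu\<close> is the value of \<open>log u\<^sub>2\<close>; for complex scalars any branch is admitted, the one that
  equals the second derivative of the free energy in \<open>t\<^sub>0\<close>.
\<close>

definition log_Lax :: "'a::field_char_0 \<Rightarrow> 'a \<Rightarrow> 'a \<Rightarrow> 'a series" where
  "log_Lax lu u1 u2 k =
     1/2 * const_series lu k
     + 1/2 * in_p_inv (log_quad u1 u2) k
     + 1/2 * in_p (log_quad (u1 / u2) (1 / u2)) k"

definition Lax_log_pow ::
  "'a::real_normed_field \<Rightarrow> 'a \<Rightarrow> 'a \<Rightarrow> nat \<Rightarrow> 'a series" where
  "Lax_log_pow lu u1 u2 n =
     times_series (Lax_pow u1 u2 (int n)) (\<lambda>k. log_Lax lu u1 u2 k - const_series (harm n) k)"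

text \<open>
  The series \<open>\<Sum>\<^bsub>m\<ge>1\<^esub> c\<^sub>m L\<^sup>-\<^sup>m\<close>.  Since \<open>L\<^sup>-\<^sup>m\<close> begins with \<open>p\<^sup>-\<^sup>m\<close>, only the terms with \<open>m \<le> -k\<close>
  contribute to the coefficient of \<open>p\<^sup>k\<close>.
\<close>

definition neg_Lax_series :: "'a::field \<Rightarrow> 'a \<Rightarrow> (nat \<Rightarrow> 'a) \<Rightarrow> 'a series" where
  "neg_Lax_series u1 u2 c k = (\<Sum>m = 1..nat (- k). c m * Lax_pow u1 u2 (- int m) k)"


section \<open>The extended dispersionless Toda hierarchy and its free energy\<close>

definition ext_dToda ::
  "'a::{real_normed_field,banach} point set \<Rightarrow>
   ('a point \<Rightarrow> 'a) \<Rightarrow> ('a point \<Rightarrow> 'a) \<Rightarrow> ('a point \<Rightarrow> 'a) \<Rightarrow> bool" where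
  "ext_dToda D lu u1 u2 \<longleftrightarrow>
     (\<forall>x\<in>D. exp (lu x) = u2 x) \<and>
     (\<forall>n\<ge>1. \<forall>x\<in>D.
        d_time (T n) (\<lambda>y. Lax (u1 y) (u2 y)) x =
        poisson (\<lambda>y. nonneg_part (Lax_pow (u1 y) (u2 y) (int n))) (\<lambda>y. Lax (u1 y) (u2 y)) x) \<and>
     (\<forall>n. \<forall>x\<in>D.
        d_time (That n) (\<lambda>y. Lax (u1 y) (u2 y)) x =
        poisson (\<lambda>y. nonneg_part (Lax_log_pow (lu y) (u1 y) (u2 y) n)) (\<lambda>y. Lax (u1 y) (u2 y)) x)"

definition free_energy ::
  "'a::{real_normed_field,banach} point set \<Rightarrow> ('a point \<Rightarrow> 'a) \<Rightarrow>
   ('a point \<Rightarrow> 'a) \<Rightarrow> ('a point \<Rightarrow> 'a) \<Rightarrow> ('a point \<Rightarrow> 'a) \<Rightarrow> bool" where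
  "free_energy D lu u1 u2 F \<longleftrightarrow>
     smooth_fun D F \<and>
     (\<forall>x\<in>D. pd (T 0) (pd (T 0) F) x = lu x) \<and>
     (\<forall>x\<in>D. in_p_inv (log_quad (u1 x) (u2 x)) =
        neg_Lax_series (u1 x) (u2 x) (\<lambda>m. pd (T 0) (pd (T m) F) x / of_nat m)) \<and>
     (\<forall>n\<ge>1. \<forall>x\<in>D. neg_part (Lax_pow (u1 x) (u2 x) (int n)) =
        neg_Lax_series (u1 x) (u2 x) (\<lambda>m. pd (T n) (pd (T m) F) x / of_nat m)) \<and>
     (\<forall>n. \<forall>x\<in>D. neg_part (Lax_log_pow (lu x) (u1 x) (u2 x) n) =
        neg_Lax_series (u1 x) (u2 x) (\<lambda>m. pd (That n) (pd (T m) F) x / of_nat m))"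

text \<open>The polynomials without constant term in the second derivatives of \<open>F\<close>.\<close>

inductive_set second_deriv_polys ::
  "('a::real_normed_field point \<Rightarrow> 'a) \<Rightarrow> ('a point \<Rightarrow> 'a) set" for F where
  deriv2: "pd i (pd j F) \<in> second_deriv_polys F"
| add: "A \<in> second_deriv_polys F \<Longrightarrow> B \<in> second_deriv_polys F \<Longrightarrow>
          (\<lambda>x. A x + B x) \<in> second_deriv_polys F"
| scale: "A \<in> second_deriv_polys F \<Longrightarrow> (\<lambda>x. c * A x) \<in> second_deriv_polys F"
| mult: "A \<in> second_deriv_polys F \<Longrightarrow> B \<in> second_deriv_polys F \<Longrightarrow>
          (\<lambda>x. A x * B x) \<in> second_deriv_polys F"

definition no_integration_constants ::
  "'a::real_normed_field point set \<Rightarrow> ('a point \<Rightarrow> 'a) \<Rightarrow> bool" where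
  "no_integration_constants D F \<longleftrightarrow>
     (\<forall>A\<in>second_deriv_polys F. \<forall>B\<in>second_deriv_polys F.
        (\<forall>x\<in>D. pd (T 0) A x = pd (T 0) B x) \<longrightarrow> (\<forall>x\<in>D. A x = B x))"

definition catalan :: "nat \<Rightarrow> 'a::field_char_0" where
  "catalan k = 1 / of_nat (k + 1) * of_nat ((2 * k) choose k)"

end

theory Submission
  imports Defs
begin

text \<open>
  Put \<open>v = log u\<^sub>2\<close>.  The hierarchy gives \<open>F\<^bsub>n^,0\<^esub> = P\<^sub>n\<close>, where \<open>P\<^sub>n(u\<^sub>1, v)\<close> is the coefficient of \<open>p\<^sup>0\<close> in
  \<open>L\<^sup>n (log L - d\<^sub>n)\<close>.  Together with \<open>F\<^sub>0\<^sub>1 = u\<^sub>1\<close> and \<open>F\<^sub>1\<^sub>1 = u\<^sub>2 = exp F\<^sub>0\<^sub>0\<close> this expresses the derivative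
  of \<open>F\<^bsub>n^,m^\<^esub>\<close> in \<open>t\<^sub>0\<close> by a differential form \<open>\<omega>(P\<^sub>n, P\<^sub>m)\<close> in \<open>u\<^sub>1, v\<close>, bilinear in the gradients, which is closed
  since every \<open>P\<^sub>n\<close> solves the wave equation \<open>P\<^sub>v\<^sub>v = u\<^sub>2 P\<^sub>u\<^sub>u\<close>.  The Euler field \<open>E = u\<^sub>1 \<partial>\<^sub>u + 2 \<partial>\<^sub>v\<close> satisfies
  \<open>E P\<^sub>n = n P\<^sub>n + Q\<^sub>n\<close> and \<open>E Q\<^sub>n = n Q\<^sub>n\<close>, with \<open>Q\<^sub>n\<close> the coefficient of \<open>p\<^sup>0\<close> in \<open>L\<^sup>n\<close>.  Hence, by Cartan's formula,
  contracting \<open>\<omega>\<close> with \<open>E\<close> yields a primitive of \<open>\<omega>(P\<^sub>n, P\<^sub>m)\<close>.  It is a polynomial without constant term in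
  the second derivatives of \<open>F\<close>, so it is equal to \<open>F\<^bsub>n^,m^\<^esub>\<close>, and it is evaluated at \<open>u\<^sub>1 = v = 0\<close>.
\<close>

unbundle fps_syntax
unbundle no vec_syntax


section \<open>Powers and logarithm of a quadratic\<close>

lemma one_plus_X_power_nth: "((1 + fps_X) ^ n) $ k = (of_nat (n choose k) :: 'a::field_char_0)"
  by (simp add: fps_binomial_of_nat[symmetric] binomial_gbinomial)

text \<open>Formally the series is the derivative of (1 + X)^n in n, so its coefficients are
  n-derivatives of binomial coefficients. The induction rests on the X-derivative: for exponent n +
  1 it is n + 1 times the series for exponent n, plus (1 + X)^n.\<close>

lemma ln_power_nth:
  fixes n m :: nat
  assumes "m \<le> n"
  shows "((1 + fps_X) ^ n * fps_ln 1) $ m = (of_nat (n choose m) * (harm n - harm (n - m)) :: 'a::real_normed_field)"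
  using assms
proof (induction n arbitrary: m)
  case 0
  then show ?case by simp
next
  case (Suc n)
  let ?f = "\<lambda>n. (1 + fps_X) ^ n * fps_ln 1 :: 'a fps"
  show ?case
  proof (cases m)
    case 0
    then show ?thesis by simp
  next
    case (Suc k)
    with Suc.prems have k: "k \<le> n" by simp
    have inv: "inverse (1 + fps_X) * (1 + fps_X) = (1 :: 'a fps)"
      by (rule inverse_mult_eq_1) simp
    have "fps_deriv ((1 + fps_X) ^ Suc n :: 'a fps) = of_nat (Suc n) * (1 + fps_X) ^ n"
      by (simp add: fps_deriv_power fps_of_nat del: power_Suc of_nat_Suc)
    then have "fps_deriv (?f (Suc n)) = of_nat (Suc n) * ?f n + (1 + fps_X) ^ Suc n * inverse (1 + fps_X)"
      by (simp only: fps_deriv_mult fps_ln_deriv) (simp add: mult_ac)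
    also have "(1 + fps_X) ^ Suc n * inverse (1 + fps_X) = (1 + fps_X :: 'a fps) ^ n * (inverse (1 + fps_X) * (1 + fps_X))"
      by (simp only: power_Suc mult_ac)
    finally have d: "fps_deriv (?f (Suc n)) = of_nat (Suc n) * ?f n + (1 + fps_X) ^ n"
      by (simp add: inv)
    have "of_nat (Suc k) * ?f (Suc n) $ Suc k = fps_deriv (?f (Suc n)) $ k"
      by (simp only: fps_deriv_nth Suc_eq_plus1)
    also have "\<dots> = of_nat (Suc n) * ?f n $ k + of_nat (n choose k)"
      unfolding d by (simp add: fps_add_nth fps_mult_of_nat_nth one_plus_X_power_nth del: of_nat_Suc)
    also have "\<dots> = of_nat (Suc n * (n choose k)) * (harm n - harm (n - k) + 1 / of_nat (Suc n))"
      unfolding Suc.IH[OF k] by (simp only: of_nat_mult distrib_left) (simp add: mult_ac del: of_nat_Suc)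
    also have "Suc n * (n choose k) = Suc k * (Suc n choose Suc k)"
      by (metis Suc_times_binomial_eq mult.commute)
    also have "harm n - harm (n - k) + 1 / of_nat (Suc n) = (harm (Suc n) - harm (Suc n - Suc k) :: 'a)"
      by (simp add: harm_Suc divide_inverse)
    finally have "of_nat (Suc k) * ?f (Suc n) $ Suc k =
        of_nat (Suc k) * (of_nat (Suc n choose Suc k) * (harm (Suc n) - harm (Suc n - Suc k)))"
      by (simp only: of_nat_mult mult.assoc)
    then have "?f (Suc n) $ Suc k = of_nat (Suc n choose Suc k) * (harm (Suc n) - harm (Suc n - Suc k))"
      using of_nat_neq_0[of k, where ?'a = 'a] by (simp only: mult_cancel_left simp_thms)
    then show ?thesis
      by (simp only: \<open>m = Suc k\<close>)
  qed
qed

text \<open>With X = p^-1 one has L = p (1 + \<open>quad_fps u w\<close>), so the coefficient of p^0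
  in L^n is that of X^n in the n-th power of \<open>1 + quad_fps u w\<close>.\<close>

definition quad_fps :: "'a::field \<Rightarrow> 'a \<Rightarrow> 'a fps" where
  "quad_fps u w = fps_const u * fps_X + fps_const w * fps_X ^ 2"

lemma quad_fps_nth_0 [simp]: "quad_fps u w $ 0 = 0"
  by (simp add: quad_fps_def)

lemma quad_fps_power_nth:
  fixes u w :: "'a::field"
  assumes "i \<le> N"
  shows "(quad_fps u w ^ i) $ N = of_nat (i choose (N - i)) * u ^ (2 * i - N) * w ^ (N - i)"
proof -
  let ?g = "\<lambda>k. fps_const (of_nat (i choose k) * (w ^ k * u ^ (i - k))) * fps_X ^ k"
  have "quad_fps u w = fps_X * (fps_const w * fps_X + fps_const u)"
    by (simp add: quad_fps_def algebra_simps power2_eq_square)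
  then have "quad_fps u w ^ i = fps_X ^ i * (fps_const w * fps_X + fps_const u) ^ i"
    by (simp add: power_mult_distrib)
  also have "(fps_const w * fps_X + fps_const u) ^ i = (\<Sum>k\<le>i. ?g k)"
    unfolding binomial_ring
    by (intro sum.cong refl) (simp add: power_mult_distrib fps_of_nat fps_const_power flip: fps_const_mult fps_of_nat fps_const_power)
  finally have "(quad_fps u w ^ i) $ N = (\<Sum>k\<le>i. ?g k $ (N - i))"
    using assms by (simp add: fps_X_power_mult_nth fps_sum_nth)
  also have "\<dots> = (\<Sum>k\<le>i. if k = N - i then of_nat (i choose k) * (w ^ k * u ^ (i - k)) else 0)"
    by (intro sum.cong refl) (simp add: fps_X_power_nth)
  also have "\<dots> = of_nat (i choose (N - i)) * u ^ (2 * i - N) * w ^ (N - i)"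
  proof -
    \<comment> \<open>Truncated subtraction does no harm: for N > 2i both sides are 0, and the
      binomial coefficient vanishes.\<close>
    have "i - (N - i) = 2 * i - N"
      using assms by simp
    then show ?thesis
      by (simp add: binomial_eq_0)
  qed
  finally show ?thesis .
qed

text \<open>The multinomial coefficient n! / (j! j! (n - 2j)!), which counts the choices of j
  factors p and j factors p^-1 in L^n; it vanishes for n < 2j.\<close>

definition trinom :: "nat \<Rightarrow> nat \<Rightarrow> nat" where
  "trinom n j = (n choose j) * ((n - j) choose j)"

text \<open>Weight 1 gives the coefficient of p^0 in L^n. The logarithm and the derivatives in v =
  log w only change the weights \<open>a\<close>, so all later identities become identities between
  weights.\<close>

definition tsum :: "nat \<Rightarrow> (nat \<Rightarrow> 'a::field) \<Rightarrow> 'a \<Rightarrow> 'a \<Rightarrow> 'a" where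
  "tsum n a u w = (\<Sum>j\<le>n. of_nat (trinom n j) * a j * u ^ (n - 2 * j) * w ^ j)"

lemma compose_quad_nth:
  fixes u w :: "'a::field"
  assumes "\<And>j. j \<le> n \<Longrightarrow> f $ (n - j) = of_nat (n choose j) * a j"
  shows "fps_compose f (quad_fps u w) $ n = tsum n a u w"
proof -
  have "fps_compose f (quad_fps u w) $ n = (\<Sum>i\<le>n. f $ i * (quad_fps u w ^ i) $ n)"
    by (simp add: fps_compose_nth atMost_atLeast0)
  also have "\<dots> = (\<Sum>j\<le>n. f $ (n - j) * (quad_fps u w ^ (n - j)) $ n)"
    by (rule sum.reindex_bij_witness[of _ "\<lambda>j. n - j" "\<lambda>j. n - j"]) auto
  also have "\<dots> = tsum n a u w"
    unfolding tsum_def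
  proof (intro sum.cong refl)
    fix j assume "j \<in> {..n}"
    then show "f $ (n - j) * (quad_fps u w ^ (n - j)) $ n = of_nat (trinom n j) * a j * u ^ (n - 2 * j) * w ^ j"
      using assms[of j] quad_fps_power_nth[of "n - j" n u w] by (simp add: trinom_def algebra_simps)
  qed
  finally show ?thesis .
qed

lemma power_quad_compose: "(1 + quad_fps u w) ^ n = fps_compose ((1 + fps_X) ^ n) (quad_fps u w)"
  by (simp add: fps_compose_power[symmetric] fps_compose_add_distrib)

lemma power_quad_nth:
  fixes u w :: "'a::field_char_0"
  shows "((1 + quad_fps u w) ^ n) $ n = tsum n (\<lambda>_. 1) u w"
  unfolding power_quad_compose
  by (rule compose_quad_nth) (simp add: one_plus_X_power_nth flip: binomial_symmetric)

lemma power_quad_log_nth: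
  fixes u w :: "'a::real_normed_field"
  shows "((1 + quad_fps u w) ^ n * log_quad u w) $ n = tsum n (\<lambda>j. harm n - harm j) u w"
proof -
  have "(1 + quad_fps u w) ^ n * log_quad u w = fps_compose ((1 + fps_X) ^ n * fps_ln 1) (quad_fps u w)"
    by (simp add: power_quad_compose log_quad_def fps_compose_mult_distrib flip: quad_fps_def)
  moreover have "fps_compose ((1 + fps_X) ^ n * fps_ln 1) (quad_fps u w) $ n = tsum n (\<lambda>j. harm n - harm j) u w"
    by (rule compose_quad_nth) (simp add: ln_power_nth flip: binomial_symmetric)
  ultimately show ?thesis by simp
qed


section \<open>Sums over central trinomial coefficients\<close>

lemma trinom_eq_0: "n < j \<Longrightarrow> trinom n j = 0"
  by (simp add: trinom_def binomial_eq_0)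

lemma trinom_eq_0': "n < 2 * j \<Longrightarrow> trinom n j = 0"
  by (cases "n < j") (auto simp: trinom_def binomial_eq_0)

text \<open>This recursion governs the derivative in u, and the next one,
  \<open>trinom_Suc_Suc\<close>, the second derivative in v.\<close>

lemma trinom_Suc: "(Suc n - 2 * j) * trinom (Suc n) j = Suc n * trinom n j"
proof -
  have e: "Suc n - 2 * j = Suc n - j - j"
    by simp
  have "(Suc n - 2 * j) * trinom (Suc n) j = (Suc n choose j) * ((Suc n - j - j) * (Suc n - j choose j))"
    unfolding trinom_def e by (simp only: mult_ac)
  also have "\<dots> = ((Suc n - j) * (Suc n choose j)) * (n - j choose j)"
    by (simp only: binomial_absorb_comp[of "Suc n - j" j]) (simp add: mult_ac)
  also have "\<dots> = Suc n * trinom n j"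
    unfolding binomial_absorb_comp by (simp only: trinom_def diff_Suc_1 mult_ac)
  finally show ?thesis .
qed

lemma trinom_Suc_Suc: "Suc j ^ 2 * trinom (Suc (Suc n)) (Suc j) = Suc (Suc n) * Suc n * trinom n j"
proof (cases "j \<le> n")
  case True
  then have d: "Suc (Suc n) - Suc j = Suc (n - j)"
    by simp
  have "Suc j ^ 2 * trinom (Suc (Suc n)) (Suc j) =
      (Suc j * (Suc (Suc n) choose Suc j)) * (Suc j * (Suc (n - j) choose Suc j))"
    unfolding trinom_def d by (simp only: power2_eq_square mult_ac)
  also have "\<dots> = Suc (Suc n) * ((Suc n - j) * (Suc n choose j)) * (n - j choose j)"
    unfolding binomial_absorption using True by (simp only: Suc_diff_le diff_Suc_1 mult_ac)
  also have "\<dots> = Suc (Suc n) * Suc n * trinom n j"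
    unfolding binomial_absorb_comp by (simp only: trinom_def diff_Suc_1 mult_ac)
  finally show ?thesis .
next
  case False
  then show ?thesis by (simp add: trinom_eq_0 trinom_eq_0')
qed

lemma tsum_extend:
  assumes "n \<le> M"
  shows "tsum n a u w = (\<Sum>j\<le>M. of_nat (trinom n j) * a j * u ^ (n - 2 * j) * w ^ j)"
  unfolding tsum_def using assms
  by (intro sum.mono_neutral_left) (auto simp: trinom_eq_0)

lemma tsum_cong: "(\<And>j. j \<le> n \<Longrightarrow> a j = b j) \<Longrightarrow> tsum n a u w = tsum n b u w"
  by (simp add: tsum_def)

lemma tsum_add: "tsum n (\<lambda>j. a j + b j) u w = tsum n a u w + tsum n b u w"
  by (simp add: tsum_def sum.distrib algebra_simps)

lemma tsum_diff: "tsum n (\<lambda>j. a j - b j) u w = tsum n a u w - tsum n b u w"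
  by (simp add: tsum_def sum_subtractf algebra_simps)

lemma tsum_scale: "tsum n (\<lambda>j. c * a j) u w = c * tsum n a u w"
  by (simp add: tsum_def sum_distrib_left algebra_simps)

lemma tsum_term_u:
  "of_nat (trinom n j) * a j * (of_nat (n - 2 * j) * u ^ (n - 2 * j - 1)) * w ^ j =
   of_nat n * (of_nat (trinom (n - 1) j) * a j * u ^ (n - 1 - 2 * j) * w ^ j :: 'a::field_char_0)"
proof (cases n)
  case (Suc k)
  have "of_nat (n - 2 * j) * of_nat (trinom n j) = (of_nat n * of_nat (trinom k j) :: 'a)"
    using trinom_Suc[of k j] Suc by (simp only: flip: of_nat_mult)
  then show ?thesis
    using Suc by (simp add: mult_ac del: of_nat_Suc)
qed simp

text \<open>The chain rule along a curve. The assumption on \<open>W\<close> says that w = exp v up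
  to a constant factor, so the derivative in v multiplies the j-th weight by j.\<close>

lemma tsum_has_derivative:
  assumes "(U has_field_derivative U') (at s)" "(W has_field_derivative W s * v') (at s)"
  shows "((\<lambda>s. tsum n a (U s) (W s)) has_field_derivative
     of_nat n * tsum (n - 1) a (U s) (W s) * U' + tsum n (\<lambda>j. of_nat j * a j) (U s) (W s) * v') (at s)"
proof -
  let ?t = "\<lambda>j. of_nat (trinom n j) * a j * (of_nat (n - 2 * j) * U s ^ (n - 2 * j - 1)) * W s ^ j"
  let ?r = "\<lambda>j. of_nat (trinom n j) * (of_nat j * a j) * U s ^ (n - 2 * j) * W s ^ j"
  have "((\<lambda>s. of_nat (trinom n j) * a j * U s ^ (n - 2 * j) * W s ^ j) has_field_derivative
      ?t j * U' + ?r j * v') (at s)" for j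
    by (rule derivative_eq_intros refl assms)+ (cases j; simp add: algebra_simps del: of_nat_Suc)
  then have "((\<lambda>s. tsum n a (U s) (W s)) has_field_derivative (\<Sum>j\<le>n. ?t j * U' + ?r j * v')) (at s)"
    unfolding tsum_def by (intro DERIV_sum) auto
  also have "(\<Sum>j\<le>n. ?t j * U' + ?r j * v') =
      of_nat n * (\<Sum>j\<le>n. of_nat (trinom (n - 1) j) * a j * U s ^ (n - 1 - 2 * j) * W s ^ j) * U' + (\<Sum>j\<le>n. ?r j) * v'"
    by (simp only: tsum_term_u sum.distrib sum_distrib_left sum_distrib_right)
  also have "(\<Sum>j\<le>n. of_nat (trinom (n - 1) j) * a j * U s ^ (n - 1 - 2 * j) * W s ^ j) = tsum (n - 1) a (U s) (W s)"
    by (rule tsum_extend[symmetric]) simp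
  finally show ?thesis by (simp add: tsum_def)
qed

text \<open>Every monomial u^(n - 2j) w^j is homogeneous of degree n when u has degree 1 and w has
  degree 2.\<close>

lemma tsum_euler:
  "u * (of_nat n * tsum (n - 1) a u w) + 2 * tsum n (\<lambda>j. of_nat j * a j) u w = of_nat n * (tsum n a u w :: 'a::field_char_0)"
proof -
  have "u * (of_nat n * tsum (n - 1) a u w) =
      (\<Sum>j\<le>n. u * (of_nat n * (of_nat (trinom (n - 1) j) * a j * u ^ (n - 1 - 2 * j) * w ^ j)))"
    unfolding tsum_extend[OF diff_le_self] sum_distrib_left ..
  also have "\<dots> = (\<Sum>j\<le>n. of_nat (n - 2 * j) * (of_nat (trinom n j) * a j * u ^ (n - 2 * j) * w ^ j))"
  proof (intro sum.cong refl)
    fix j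
    have "u * (of_nat (n - 2 * j) * u ^ (n - 2 * j - 1)) = of_nat (n - 2 * j) * u ^ (n - 2 * j)"
      by (cases "n - 2 * j") auto
    then show "u * (of_nat n * (of_nat (trinom (n - 1) j) * a j * u ^ (n - 1 - 2 * j) * w ^ j)) =
      of_nat (n - 2 * j) * (of_nat (trinom n j) * a j * u ^ (n - 2 * j) * w ^ j)"
      unfolding tsum_term_u[symmetric] by (simp add: mult_ac)
  qed
  finally have "u * (of_nat n * tsum (n - 1) a u w) + 2 * tsum n (\<lambda>j. of_nat j * a j) u w =
    (\<Sum>j\<le>n. of_nat (n - 2 * j) * (of_nat (trinom n j) * a j * u ^ (n - 2 * j) * w ^ j) +
      2 * (of_nat (trinom n j) * (of_nat j * a j) * u ^ (n - 2 * j) * w ^ j))"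
    by (simp add: tsum_def sum.distrib sum_distrib_left)
  also have "\<dots> = of_nat n * tsum n a u w"
    unfolding tsum_def sum_distrib_left
  proof (intro sum.cong refl)
    fix j
    show "of_nat (n - 2 * j) * (of_nat (trinom n j) * a j * u ^ (n - 2 * j) * w ^ j) +
      2 * (of_nat (trinom n j) * (of_nat j * a j) * u ^ (n - 2 * j) * w ^ j) =
      of_nat n * (of_nat (trinom n j) * a j * u ^ (n - 2 * j) * w ^ j)"
    proof (cases "2 * j \<le> n")
      case True
      then have "(of_nat n :: 'a) = of_nat (n - 2 * j) + 2 * of_nat j"
        by (simp add: of_nat_diff)
      then show ?thesis by (simp add: algebra_simps)
    qed (simp add: trinom_eq_0')
  qed
  finally show ?thesis .
qed

text \<open>The shift from j to j + 1 combined with \<open>trinom_Suc_Suc\<close>. Letting the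
  weights shift as well makes room for harmonic numbers.\<close>

lemma tsum_wave:
  assumes "\<And>j. b (Suc j) = of_nat (Suc j) ^ 2 * a j" "b 0 = 0"
  shows "tsum n b u w = w * (of_nat n * (of_nat (n - 1) * tsum (n - 2) a u (w :: 'a::field_char_0)))"
proof (cases "n < 2")
  case True
  then consider "n = 0" | "n = 1" by linarith
  then show ?thesis
    by cases (simp_all add: tsum_def assms trinom_def)
next
  case False
  then obtain m where n: "n = Suc (Suc m)"
    by (metis add_2_eq_Suc le_Suc_ex not_le)
  have "tsum n b u w = (\<Sum>j\<le>Suc m. of_nat (trinom n (Suc j)) * b (Suc j) * u ^ (n - 2 * Suc j) * w ^ Suc j)"
    unfolding tsum_def n sum.atMost_Suc_shift[of _ "Suc m"] by (simp add: assms)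
  also have "\<dots> = (\<Sum>j\<le>Suc m. w * (of_nat n * (of_nat (n - 1) *
      (of_nat (trinom m j) * a j * u ^ (m - 2 * j) * w ^ j))))"
  proof (intro sum.cong refl)
    fix j
    have "of_nat (Suc j) ^ 2 * of_nat (trinom n (Suc j)) = (of_nat n * of_nat (n - 1) * of_nat (trinom m j) :: 'a)"
      using trinom_Suc_Suc[of j m] n by (simp only: diff_Suc_1 flip: of_nat_mult of_nat_power)
    then have "of_nat (trinom n (Suc j)) * b (Suc j) = of_nat n * of_nat (n - 1) * of_nat (trinom m j) * a j"
      by (simp only: assms mult_ac)
    moreover have "n - 2 * Suc j = m - 2 * j"
      using n by simp
    ultimately show "of_nat (trinom n (Suc j)) * b (Suc j) * u ^ (n - 2 * Suc j) * w ^ Suc j =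
        w * (of_nat n * (of_nat (n - 1) * (of_nat (trinom m j) * a j * u ^ (m - 2 * j) * w ^ j)))"
      by (simp add: mult_ac)
  qed
  also have "\<dots> = w * (of_nat n * (of_nat (n - 1) * tsum (n - 2) a u w))"
    by (simp only: sum_distrib_left[symmetric]) (simp add: n tsum_extend[of m "Suc m"])
  finally show ?thesis .
qed

lemma tsum_at_0_1:
  "tsum n a 0 1 = (if even n then of_nat (n choose (n div 2)) * a (n div 2) else 0)"
proof -
  have "tsum n a 0 1 = (\<Sum>j\<le>n. if 2 * j = n then of_nat (n choose j) * a j else 0)"
    unfolding tsum_def
  proof (intro sum.cong refl)
    fix j
    show "of_nat (trinom n j) * a j * 0 ^ (n - 2 * j) * 1 ^ j = (if 2 * j = n then of_nat (n choose j) * a j else 0)"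
      by (cases "n < 2 * j") (auto simp: trinom_eq_0' trinom_def power_0_left binomial_eq_0)
  qed
  also have "\<dots> = (if even n then of_nat (n choose (n div 2)) * a (n div 2) else 0)"
  proof (cases "even n")
    case True
    then have "(2 * j = n) = (n div 2 = j)" for j by auto
    then show ?thesis using True by simp
  next
    case False
    then have "2 * j \<noteq> n" for j by auto
    then show ?thesis using False by simp
  qed
  finally show ?thesis .
qed


section \<open>The Lax function\<close>

lemma Lax_fls_eq: "Lax_fls u w = fls_X_inv * fps_to_fls (1 + quad_fps u w)"
proof -
  have "fls_X_inv * fls_X = (1 :: 'a fls)"
    by (simp add: fls_X_inv_times_conv_shift fls_X_conv_shift_1)
  moreover have "fls_X_inv * (1 + (fls_const u * fls_X + fls_const w * (fls_X * fls_X))) =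
      fls_X_inv + (fls_const u * (fls_X_inv * fls_X) + fls_const w * (fls_X * (fls_X_inv * fls_X)))"
    by (simp only: distrib_left mult_ac mult_1_right)
  moreover have "fps_to_fls (1 + quad_fps u w) = 1 + (fls_const u * fls_X + fls_const w * (fls_X * fls_X))"
    by (simp add: quad_fps_def power2_eq_square fls_times_fps_to_fls)
  ultimately show ?thesis
    by (simp add: Lax_fls_def add.assoc)
qed

lemma Lax_pow_of_nat:
  "Lax_pow u w (int n) k = (if k \<le> int n then ((1 + quad_fps u w) ^ n) $ nat (int n - k) else 0)"
  by (simp add: Lax_pow_def Lax_fls_eq power_mult_distrib fps_to_fls_power[symmetric]
      fls_X_inv_power_times_conv_shift del: fps_to_fls_plus)

lemma Lax_pow_0: "Lax_pow u w 0 k = (if k = 0 then 1 else 0)"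
  by (simp add: Lax_pow_def)

lemma Lax_pow_Suc:
  "Lax_pow u w (int (Suc n)) k =
     Lax_pow u w (int n) (k - 1) + u * Lax_pow u w (int n) k + w * Lax_pow u w (int n) (k + 1)"
proof -
  have "Lax_pow u w (int (Suc n)) k = (Lax_fls u w * Lax_fls u w ^ n) $$ (- k)"
    unfolding Lax_pow_def power_int_of_nat by simp
  also have "\<dots> = (fls_X_inv * Lax_fls u w ^ n) $$ (- k) + (fls_const u * Lax_fls u w ^ n) $$ (- k)
     + (fls_const w * (fls_X * Lax_fls u w ^ n)) $$ (- k)"
    by (subst (1) Lax_fls_def) (simp add: algebra_simps)
  also have "\<dots> = Lax_pow u w (int n) (k - 1) + u * Lax_pow u w (int n) k + w * Lax_pow u w (int n) (k + 1)"
    by (simp add: Lax_pow_def fls_X_inv_times_conv_shift fls_X_times_conv_shift algebra_simps)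
  finally show ?thesis .
qed

lemma Lax_1: "Lax u w k = (if k = 1 then 1 else if k = 0 then u else if k = -1 then w else 0)"
  using Lax_pow_Suc[of u w 0 k] by (auto simp: Lax_pow_0)

text \<open>L is invariant under the substitution of w / p for p.\<close>

lemma Lax_pow_uminus:
  assumes "w \<noteq> 0"
  shows "Lax_pow u w (int n) (- k) = w powi k * Lax_pow u w (int n) k"
proof (induction n arbitrary: k)
  case 0
  then show ?case by (simp add: Lax_pow_0)
next
  case (Suc n)
  have "w powi (k + 1) = w powi k * w" "w powi k = w powi (k - 1) * w"
    using assms power_int_add_1[of w k] power_int_add_1[of w "k - 1"] by simp_all
  moreover have "- k - 1 = - (k + 1)" "- k + 1 = - (k - 1)"
    by simp_all
  ultimately show ?case
    using Suc[of "k + 1"] Suc[of k] Suc[of "k - 1"]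
    by (simp only: Lax_pow_Suc) (simp add: algebra_simps)
qed

lemma Lax_pow_eq_0:
  assumes "w \<noteq> 0" "\<bar>k\<bar> > int n"
  shows "Lax_pow u w (int n) k = 0"
  using assms Lax_pow_uminus[of w u n "- k"] by (cases "k > 0") (auto simp: Lax_pow_of_nat)

lemma Lax_pow_nth_0: "Lax_pow u w (int n) 0 = tsum n (\<lambda>_. 1) u (w :: 'a::field_char_0)"
  by (simp add: Lax_pow_of_nat power_quad_nth)

text \<open>Replacing X by X / w turns 1 + u X + w X^2 into 1 + (u / w) X + X^2 / w.\<close>

lemma log_quad_inverse_nth:
  assumes "w \<noteq> (0 :: 'a::field_char_0)"
  shows "log_quad (u / w) (1 / w) $ m = log_quad u w $ m / w ^ m"
proof -
  have eq: "quad_fps (u / w) (1 / w) = fps_compose (quad_fps u w) (fps_const (1 / w) * fps_X)"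
    unfolding quad_fps_def using assms
    by (auto simp: fps_eq_iff fps_compose_linear fps_X_power_nth power_divide le_Suc_eq) (simp add: power2_eq_square)
  have "log_quad (u / w) (1 / w) = fps_compose (log_quad u w) (fps_const (1 / w) * fps_X)"
    unfolding log_quad_def quad_fps_def[symmetric] eq by (rule fps_compose_assoc) simp_all
  then show ?thesis
    by (simp add: fps_compose_linear power_divide)
qed

section \<open>The coefficient of p^0 in L^n (log L - d_n)\<close>

lemma times_series_eq_sum:
  assumes "finite S" "\<And>j. j \<notin> S \<Longrightarrow> A j * B (k - j) = 0"
  shows "times_series A B k = (\<Sum>j\<in>S. A j * B (k - j))"
  unfolding times_series_def using assms by (intro sum.mono_neutral_left) fastforce+

lemma sum_int_interval_nonneg:
  assumes "\<And>j. j < 0 \<Longrightarrow> f j = 0"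
  shows "(\<Sum>j\<in>{- int n..int n}. f j) = (\<Sum>i\<le>n. f (int i))"
proof -
  have "(\<Sum>i\<le>n. f (int i)) = (\<Sum>j\<in>{0..int n}. f j)"
    by (rule sum.reindex_bij_witness[of _ nat int]) auto
  also have "\<dots> = (\<Sum>j\<in>{- int n..int n}. f j)"
    by (rule sum.mono_neutral_left) (auto intro: assms)
  finally show ?thesis by simp
qed

lemma sum_int_interval_nonpos:
  assumes "\<And>j. j > 0 \<Longrightarrow> f j = 0"
  shows "(\<Sum>j\<in>{- int n..int n}. f j) = (\<Sum>i\<le>n. f (- int i))"
proof -
  have "(\<Sum>j\<in>{- int n..int n}. f j) = (\<Sum>j\<in>{- int n..int n}. f (- j))"
    by (rule sum.reindex_bij_witness[of _ uminus uminus]) auto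
  also have "\<dots> = (\<Sum>i\<le>n. f (- int i))"
    by (rule sum_int_interval_nonneg) (simp add: assms)
  finally show ?thesis .
qed

text \<open>By the symmetry between p and w / p, the expansions in p^-1 and in p contribute equally,
  so the two halves add up to one full sum. Its term \<open>harm n\<close> cancels the subtracted
  d_n.\<close>

lemma Lax_log_pow_nth_0:
  fixes u w :: "'a::real_normed_field"
  assumes "w \<noteq> 0"
  shows "Lax_log_pow lu u w n 0 = lu / 2 * tsum n (\<lambda>_. 1) u w - tsum n harm u w"
proof -
  let ?A = "Lax_pow u w (int n)" and ?I = "{- int n..int n}"
  have conv: "(\<Sum>i\<le>n. ?A (int i) * log_quad u w $ i) = ((1 + quad_fps u w) ^ n * log_quad u w) $ n"
    unfolding mult.commute[of _ "log_quad u w"] fps_mult_nth atMost_atLeast0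
    by (intro sum.cong refl) (simp add: Lax_pow_of_nat nat_diff_distrib mult.commute)
  have *: "(\<Sum>i\<le>n. ?A (int i) * log_quad u w $ i) = harm n * tsum n (\<lambda>_. 1) u w - tsum n harm u w"
    unfolding conv power_quad_log_nth tsum_diff using tsum_scale[of n "harm n" "\<lambda>_. 1" u w] by simp
  have c: "(\<Sum>j\<in>?I. ?A j * const_series c (- j)) = c * tsum n (\<lambda>_. 1) u w" for c
  proof -
    have "(\<Sum>j\<in>?I. ?A j * const_series c (- j)) = (\<Sum>i\<le>n. ?A (int i) * const_series c (- int i))"
      by (rule sum_int_interval_nonneg) (simp add: const_series_def)
    also have "\<dots> = (\<Sum>i\<le>n. if i = 0 then c * tsum n (\<lambda>_. 1) u w else 0)"
      by (intro sum.cong refl) (simp add: const_series_def Lax_pow_nth_0)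
    finally show ?thesis by simp
  qed
  have i: "(\<Sum>j\<in>?I. ?A j * in_p_inv (log_quad u w) (- j)) = (\<Sum>i\<le>n. ?A (int i) * log_quad u w $ i)"
    by (subst sum_int_interval_nonneg) (simp_all add: in_p_inv_def)
  have p: "(\<Sum>j\<in>?I. ?A j * in_p (log_quad (u / w) (1 / w)) (- j)) = (\<Sum>i\<le>n. ?A (int i) * log_quad u w $ i)"
    by (subst sum_int_interval_nonpos)
      (use assms in \<open>simp_all add: in_p_def Lax_pow_uminus log_quad_inverse_nth\<close>)
  have "Lax_log_pow lu u w n 0 = (\<Sum>j\<in>?I. ?A j * (log_Lax lu u w (0 - j) - const_series (harm n) (0 - j)))"
    unfolding Lax_log_pow_def using assms by (intro times_series_eq_sum) (auto simp: Lax_pow_eq_0)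
  also have "\<dots> = (\<Sum>j\<in>?I. ?A j * const_series (lu / 2) (- j)
      + 1/2 * (?A j * in_p_inv (log_quad u w) (- j))
      + 1/2 * (?A j * in_p (log_quad (u / w) (1 / w)) (- j))
      - ?A j * const_series (harm n) (- j))"
    by (intro sum.cong refl) (simp add: log_Lax_def const_series_def algebra_simps)
  also have "\<dots> = lu / 2 * tsum n (\<lambda>_. 1) u w + (\<Sum>i\<le>n. ?A (int i) * log_quad u w $ i) - harm n * tsum n (\<lambda>_. 1) u w"
    by (simp only: sum.distrib sum_subtractf sum_distrib_left[symmetric] c i p) simp
  finally show ?thesis by (simp add: *)
qed


section \<open>Solutions of the wave equation\<close>

text \<open>
  With \<open>(c, e) = (1, 0)\<close> this is the coefficient of \<open>p\<^sup>0\<close> in \<open>L\<^sup>n (log L - d\<^sub>n)\<close>, with \<open>(c, e) = (0, 1)\<close> the one in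
  \<open>L\<^sup>n\<close>; \<open>w\<close> stands for \<open>exp v\<close>.  The partial derivative in \<open>u\<close> is \<open>n * toda c e (n - 1)\<close>, and \<open>toda_v\<close> is the
  one in \<open>v\<close>.
\<close>

definition toda :: "'a::real_normed_field \<Rightarrow> 'a \<Rightarrow> nat \<Rightarrow> 'a \<Rightarrow> 'a \<Rightarrow> 'a \<Rightarrow> 'a" where
  "toda c e n u w v = tsum n (\<lambda>j. c * (v / 2 - harm j) + e) u w"

definition toda_v :: "'a::real_normed_field \<Rightarrow> 'a \<Rightarrow> nat \<Rightarrow> 'a \<Rightarrow> 'a \<Rightarrow> 'a \<Rightarrow> 'a" where
  "toda_v c e n u w v = tsum n (\<lambda>j. of_nat j * (c * (v / 2 - harm j) + e) + c / 2) u w"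

lemma toda_eq: "toda c e n u w v = c / 2 * v * tsum n (\<lambda>_. 1) u w + tsum n (\<lambda>j. e - c * harm j) u w"
proof -
  have "toda c e n u w v = tsum n (\<lambda>j. c / 2 * v * 1 + (e - c * harm j)) u w"
    unfolding toda_def by (rule tsum_cong) (simp add: algebra_simps)
  then show ?thesis by (simp only: tsum_add tsum_scale)
qed

lemma toda_v_eq:
  "toda_v c e n u w v =
     c / 2 * v * tsum n of_nat u w + tsum n (\<lambda>j. of_nat j * (e - c * harm j) + c / 2) u w"
proof -
  have "toda_v c e n u w v = tsum n (\<lambda>j. c / 2 * v * of_nat j + (of_nat j * (e - c * harm j) + c / 2)) u w"
    unfolding toda_v_def by (rule tsum_cong) (simp add: algebra_simps)
  then show ?thesis by (simp only: tsum_add tsum_scale)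
qed

lemma tsum_zero [simp]: "tsum n (\<lambda>_. 0) u w = 0"
  by (simp add: tsum_def)

lemma toda_0_0 [simp]: "toda 0 0 n u w v = 0"
  by (simp add: toda_def)

lemma toda_v_0_0 [simp]: "toda_v 0 0 n u w v = 0"
  by (simp add: toda_v_def)

text \<open>The weights on the left are those of the second v-derivative. As H_j - 1/j = H_(j-1),
  they equal j^2 times the weight of \<open>toda\<close> at j - 1, which is the form
  \<open>tsum_wave\<close> asks for.\<close>

lemma toda_wave:
  "tsum n (\<lambda>j. of_nat j * (of_nat j * (c * (v / 2 - harm j) + e) + c)) u w =
     w * (of_nat n * (of_nat (n - 1) * toda c e (n - 2) u w v))"
  unfolding toda_def by (rule tsum_wave) (simp_all add: harm_Suc power2_eq_square field_simps del: of_nat_Suc)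

lemma toda_has_derivative:
  assumes U: "(U has_field_derivative U') (at s)" and W: "(W has_field_derivative W s * V') (at s)"
    and V: "(V has_field_derivative V') (at s)"
  shows "((\<lambda>s. toda c e n (U s) (W s) (V s)) has_field_derivative
     of_nat n * toda c e (n - 1) (U s) (W s) (V s) * U' + toda_v c e n (U s) (W s) (V s) * V') (at s)"
proof -
  have v: "toda_v c e n (U s) (W s) (V s) = c / 2 * V s * tsum n (\<lambda>j. of_nat j * 1) (U s) (W s)
      + (tsum n (\<lambda>j. of_nat j * (e - c * harm j)) (U s) (W s) + c / 2 * tsum n (\<lambda>_. 1) (U s) (W s))"
    unfolding toda_v_eq tsum_add using tsum_scale[of n "c / 2" "\<lambda>_. 1" "U s" "W s"] by simp
  show ?thesis
    unfolding v toda_eq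
    by (rule DERIV_cong[OF DERIV_add[OF DERIV_mult[OF DERIV_cmult[OF V, of "c / 2"] tsum_has_derivative[OF U W]]
          tsum_has_derivative[OF U W]]]) (simp add: algebra_simps)
qed

lemma toda_v_has_derivative:
  assumes U: "(U has_field_derivative U') (at s)" and W: "(W has_field_derivative W s * V') (at s)"
    and V: "(V has_field_derivative V') (at s)"
  shows "((\<lambda>s. toda_v c e n (U s) (W s) (V s)) has_field_derivative
     of_nat n * toda_v c e (n - 1) (U s) (W s) (V s) * U' +
     W s * (of_nat n * (of_nat (n - 1) * toda c e (n - 2) (U s) (W s) (V s))) * V') (at s)"
proof -
  have "tsum n (\<lambda>j. of_nat j * (of_nat j * (c * (V s / 2 - harm j) + e) + c)) (U s) (W s) =
      tsum n (\<lambda>j. c / 2 * V s * (of_nat j * of_nat j) + (of_nat j * (of_nat j * (e - c * harm j) + c / 2) + c / 2 * of_nat j)) (U s) (W s)"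
    by (rule tsum_cong) (simp add: field_simps)
  then have v: "W s * (of_nat n * (of_nat (n - 1) * toda c e (n - 2) (U s) (W s) (V s))) =
      c / 2 * V s * tsum n (\<lambda>j. of_nat j * of_nat j) (U s) (W s)
      + (tsum n (\<lambda>j. of_nat j * (of_nat j * (e - c * harm j) + c / 2)) (U s) (W s) + c / 2 * tsum n of_nat (U s) (W s))"
    unfolding toda_wave by (simp only: tsum_add tsum_scale)
  show ?thesis
    unfolding v toda_v_eq
    by (rule DERIV_cong[OF DERIV_add[OF DERIV_mult[OF DERIV_cmult[OF V, of "c / 2"] tsum_has_derivative[OF U W]]
          tsum_has_derivative[OF U W]]]) (simp add: algebra_simps)
qed

text \<open>Homogeneity gives the factor n; the explicit v in the weights adds 2 * (c / 2) = c to
  each of them, which is the term \<open>toda 0 c n\<close>.\<close>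

lemma toda_euler:
  "u * (of_nat n * toda c e (n - 1) u w v) + 2 * toda_v c e n u w v = of_nat n * toda c e n u w v + toda 0 c n u w v"
proof -
  have "2 * toda_v c e n u w v = 2 * tsum n (\<lambda>j. of_nat j * (c * (v / 2 - harm j) + e)) u w + toda 0 c n u w v"
    unfolding toda_v_def toda_def tsum_add distrib_left by (simp flip: tsum_scale)
  then show ?thesis
    using tsum_euler[of u n "\<lambda>j. c * (v / 2 - harm j) + e" w] by (simp add: toda_def algebra_simps)
qed

text \<open>The u-derivative of \<open>toda_euler\<close>. Since this derivative lowers the index,
  it is n times \<open>toda_euler\<close> at n - 1.\<close>

lemma toda_euler_u:
  "u * (of_nat n * (of_nat (n - 1) * toda c e (n - 2) u w v)) + 2 * (of_nat n * toda_v c e (n - 1) u w v) =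
     (of_nat n - 1) * (of_nat n * toda c e (n - 1) u w v) + of_nat n * toda 0 c (n - 1) u w v"
proof (cases n)
  case (Suc k)
  show ?thesis
    using arg_cong[OF toda_euler[of u k c e w v], of "\<lambda>x. of_nat n * x"]
    by (simp add: Suc algebra_simps numeral_2_eq_2)
qed simp

text \<open>The v-derivative of \<open>toda_euler\<close>, with the second v-derivative rewritten by
  the wave equation.\<close>

lemma toda_euler_v:
  "u * (of_nat n * toda_v c e (n - 1) u w v) + 2 * (w * (of_nat n * (of_nat (n - 1) * toda c e (n - 2) u w v))) =
     of_nat n * toda_v c e n u w v + toda_v 0 c n u w v"
proof -
  define b where "b j = of_nat j * (c * (v / 2 - harm j) + e) + c / 2" for j
  define X where "X = tsum n (\<lambda>j. of_nat j * b j) u w"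
  have "w * (of_nat n * (of_nat (n - 1) * toda c e (n - 2) u w v)) =
      tsum n (\<lambda>j. of_nat j * b j + 1 / 2 * (of_nat j * c)) u w"
    unfolding toda_wave[symmetric] by (rule tsum_cong) (simp add: b_def field_simps)
  also have "\<dots> = X + 1 / 2 * tsum n (\<lambda>j. of_nat j * c) u w"
    unfolding X_def by (rule trans[OF tsum_add]) (simp only: tsum_scale)
  also have "tsum n (\<lambda>j. of_nat j * c) u w = toda_v 0 c n u w v"
    by (simp add: toda_v_def)
  finally have wave: "w * (of_nat n * (of_nat (n - 1) * toda c e (n - 2) u w v)) = X + 1 / 2 * toda_v 0 c n u w v" .
  have "u * (of_nat n * toda_v c e (n - 1) u w v) + 2 * X = of_nat n * toda_v c e n u w v"
    unfolding toda_v_def b_def[symmetric] X_def by (rule tsum_euler)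
  then show ?thesis
    unfolding wave by (simp add: distrib_left add.assoc[symmetric])
qed

text \<open>
  The form \<open>\<omega>(f, g) = (f\<^sub>u g\<^sub>v + f\<^sub>v g\<^sub>u) du + (w f\<^sub>u g\<^sub>u + f\<^sub>v g\<^sub>v) dv\<close> and its contraction with the Euler field.
\<close>

definition pair_u :: "'a::real_normed_field \<Rightarrow> 'a \<Rightarrow> nat \<Rightarrow> 'a \<Rightarrow> 'a \<Rightarrow> nat \<Rightarrow> 'a \<Rightarrow> 'a \<Rightarrow> 'a \<Rightarrow> 'a" where
  "pair_u c e n c' e' m u w v =
     of_nat n * toda c e (n - 1) u w v * toda_v c' e' m u w v +
     toda_v c e n u w v * (of_nat m * toda c' e' (m - 1) u w v)"

definition pair_v :: "'a::real_normed_field \<Rightarrow> 'a \<Rightarrow> nat \<Rightarrow> 'a \<Rightarrow> 'a \<Rightarrow> nat \<Rightarrow> 'a \<Rightarrow> 'a \<Rightarrow> 'a \<Rightarrow> 'a" where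
  "pair_v c e n c' e' m u w v =
     w * (of_nat n * toda c e (n - 1) u w v * (of_nat m * toda c' e' (m - 1) u w v)) +
     toda_v c e n u w v * toda_v c' e' m u w v"

definition pair_E :: "'a::real_normed_field \<Rightarrow> 'a \<Rightarrow> nat \<Rightarrow> 'a \<Rightarrow> 'a \<Rightarrow> nat \<Rightarrow> 'a \<Rightarrow> 'a \<Rightarrow> 'a \<Rightarrow> 'a" where
  "pair_E c e n c' e' m u w v = u * pair_u c e n c' e' m u w v + 2 * pair_v c e n c' e' m u w v"

text \<open>Cartan's formula on a tangent vector \<open>(u', v')\<close>. The letters stand for
  partial derivatives of f and g, with \<open>w * fuu\<close> in place of f_vv; \<open>f0u\<close>,
  \<open>f0v\<close> and \<open>g0u\<close>, \<open>g0v\<close> are the gradients of the defects E f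
  - n f and E g - m g.\<close>

lemma pair_algebra:
  fixes u w u' v' :: "'a::real_normed_field"
  assumes f1: "u * fuu + 2 * fuv = (n - 1) * fu + f0u" and f2: "u * fuv + 2 * (w * fuu) = n * fv + f0v"
    and g1: "u * guu + 2 * guv = (m - 1) * gu + g0u" and g2: "u * guv + 2 * (w * guu) = m * gv + g0v"
  defines "fu' \<equiv> fuu * u' + fuv * v'" and "fv' \<equiv> fuv * u' + w * fuu * v'"
    and "gu' \<equiv> guu * u' + guv * v'" and "gv' \<equiv> guv * u' + w * guu * v'"
  shows "u' * (fu * gv + fv * gu) + u * (fu' * gv + fu * gv' + fv' * gu + fv * gu') +
      2 * (w * v' * (fu * gu) + w * (fu' * gu + fu * gu') + fv' * gv + fv * gv') =
    (n + m) * ((fu * gv + fv * gu) * u' + (w * (fu * gu) + fv * gv) * v') +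
    ((f0u * gv + f0v * gu) * u' + (w * (f0u * gu) + f0v * gv) * v') +
    ((fu * g0v + fv * g0u) * u' + (w * (fu * g0u) + fv * g0v) * v')"
proof -
  \<comment> \<open>The difference of both sides is a combination of the four relations.\<close>
  have "?thesis \<longleftrightarrow> (u * fuu + 2 * fuv - (n - 1) * fu - f0u) * (gv * u' + w * gu * v') +
     (u * fuv + 2 * (w * fuu) - n * fv - f0v) * (gu * u' + gv * v') +
     (u * guu + 2 * guv - (m - 1) * gu - g0u) * (fv * u' + w * fu * v') +
     (u * guv + 2 * (w * guu) - m * gv - g0v) * (fu * u' + fv * v') = 0"
    unfolding fu'_def fv'_def gu'_def gv'_def by (simp add: algebra_simps)
  then show ?thesis
    by (simp add: f1 f2 g1 g2)
qed

text \<open>The defect of the solution with parameters (c, e) has parameters (0, c), whence the last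
  two terms.\<close>

lemma pair_E_has_derivative:
  fixes n m :: nat
  assumes U: "(U has_field_derivative U') (at s)" and W: "(W has_field_derivative W s * V') (at s)"
    and V: "(V has_field_derivative V') (at s)"
  defines "\<omega> \<equiv> \<lambda>c e c' e'. pair_u c e n c' e' m (U s) (W s) (V s) * U' + pair_v c e n c' e' m (U s) (W s) (V s) * V'"
  shows "((\<lambda>s. pair_E c e n c' e' m (U s) (W s) (V s)) has_field_derivative
     of_nat (n + m) * \<omega> c e c' e' + \<omega> 0 c c' e' + \<omega> c e 0 c') (at s)"
proof -
  let ?f = "\<lambda>c e n. toda c e n (U s) (W s) (V s)" and ?fv = "\<lambda>c e n. toda_v c e n (U s) (W s) (V s)"
  note alg = pair_algebra[OF toda_euler_u[of "U s" n c e "W s" "V s"] toda_euler_v[of "U s" n c e "W s" "V s"]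
      toda_euler_u[of "U s" m c' e' "W s" "V s"] toda_euler_v[of "U s" m c' e' "W s" "V s"], of U' V']
  note d = derivative_eq_intros refl toda_has_derivative[OF U W V] toda_v_has_derivative[OF U W V] U W
  have "((\<lambda>s. pair_E c e n c' e' m (U s) (W s) (V s)) has_field_derivative
    U' * (of_nat n * ?f c e (n - 1) * ?fv c' e' m + ?fv c e n * (of_nat m * ?f c' e' (m - 1))) +
    U s * ((of_nat n * (of_nat (n - 1) * ?f c e (n - 2)) * U' + of_nat n * ?fv c e (n - 1) * V') * ?fv c' e' m +
       of_nat n * ?f c e (n - 1) * (of_nat m * ?fv c' e' (m - 1) * U' + W s * (of_nat m * (of_nat (m - 1) * ?f c' e' (m - 2))) * V') +
       (of_nat n * ?fv c e (n - 1) * U' + W s * (of_nat n * (of_nat (n - 1) * ?f c e (n - 2))) * V') * (of_nat m * ?f c' e' (m - 1)) +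
       ?fv c e n * (of_nat m * (of_nat (m - 1) * ?f c' e' (m - 2)) * U' + of_nat m * ?fv c' e' (m - 1) * V')) +
    2 * (W s * V' * (of_nat n * ?f c e (n - 1) * (of_nat m * ?f c' e' (m - 1))) +
       W s * ((of_nat n * (of_nat (n - 1) * ?f c e (n - 2)) * U' + of_nat n * ?fv c e (n - 1) * V') * (of_nat m * ?f c' e' (m - 1)) +
         of_nat n * ?f c e (n - 1) * (of_nat m * (of_nat (m - 1) * ?f c' e' (m - 2)) * U' + of_nat m * ?fv c' e' (m - 1) * V')) +
       (of_nat n * ?fv c e (n - 1) * U' + W s * (of_nat n * (of_nat (n - 1) * ?f c e (n - 2))) * V') * ?fv c' e' m +
       ?fv c e n * (of_nat m * ?fv c' e' (m - 1) * U' + W s * (of_nat m * (of_nat (m - 1) * ?f c' e' (m - 2))) * V'))) (at s)"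
    unfolding pair_E_def pair_u_def pair_v_def
    by (rule d)+ (simp add: algebra_simps numeral_2_eq_2)
  then show ?thesis
    unfolding alg \<omega>_def pair_u_def pair_v_def by (simp add: add_ac)
qed

text \<open>
  The derivative of the contraction of \<open>\<omega>(f, g)\<close> with \<open>E\<close> is \<open>\<omega>(E f, g) + \<omega>(f, E g)\<close>; the lower terms
  compensate for \<open>E P\<^sub>n = n P\<^sub>n + Q\<^sub>n\<close> not being a multiple of \<open>P\<^sub>n\<close>.
\<close>

definition toda2 :: "nat \<Rightarrow> nat \<Rightarrow> 'a::real_normed_field \<Rightarrow> 'a \<Rightarrow> 'a \<Rightarrow> 'a" where
  "toda2 n m u w v =
     1 / of_nat (n + m) * pair_E 1 0 n 1 0 m u w v
     + - (1 / of_nat (n + m) ^ 2) * (pair_E 1 0 n 0 1 m u w v + pair_E 0 1 n 1 0 m u w v)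
     + 2 / of_nat (n + m) ^ 3 * pair_E 0 1 n 0 1 m u w v"

text \<open>With N = n + m, differentiating a contraction yields N + D applied to the form, where
  the derivation D sends P to Q and Q to 0. Its inverse is 1/N - D/N^2 + D^2/N^3; the coefficient 2
  in \<open>toda2\<close> arises because D^2 takes the pair (P, P) to twice (Q, Q).\<close>

lemma toda2_has_derivative:
  assumes "n + m > 0"
    and U: "(U has_field_derivative U') (at s)" and W: "(W has_field_derivative W s * V') (at s)"
    and V: "(V has_field_derivative V') (at s)"
  shows "((\<lambda>s. toda2 n m (U s) (W s) (V s)) has_field_derivative
     pair_u 1 0 n 1 0 m (U s) (W s) (V s) * U' + pair_v 1 0 n 1 0 m (U s) (W s) (V s) * V') (at s)"
proof -
  let ?w = "\<lambda>c e c' e'. pair_u c e n c' e' m (U s) (W s) (V s) * U' + pair_v c e n c' e' m (U s) (W s) (V s) * V'"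
  define N where "N = (of_nat (n + m) :: 'a)"
  have N: "N \<noteq> 0"
    using assms(1) unfolding N_def by (simp only: of_nat_eq_0_iff)
  have z: "?w 0 0 c' e' = 0" "?w c e 0 0 = 0" for c e c' e'
    by (simp_all add: pair_u_def pair_v_def)
  note d = pair_E_has_derivative[OF U W V, where n = n and m = m, folded N_def]
  have alg: "1 / N * (N * hh + ph + hp) + - (1 / N ^ 2) * ((N * hp + pp + 0) + (N * ph + 0 + pp)) +
     2 / N ^ 3 * (N * pp + 0 + 0) = hh" for hh hp ph pp
    using N by (simp add: field_simps power2_eq_square power3_eq_cube)
  have "((\<lambda>s. toda2 n m (U s) (W s) (V s)) has_field_derivative
     1 / N * (N * ?w 1 0 1 0 + ?w 0 1 1 0 + ?w 1 0 0 1) +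
     - (1 / N ^ 2) * ((N * ?w 1 0 0 1 + ?w 0 1 0 1 + ?w 1 0 0 0) + (N * ?w 0 1 1 0 + ?w 0 0 1 0 + ?w 0 1 0 1)) +
     2 / N ^ 3 * (N * ?w 0 1 0 1 + ?w 0 0 0 1 + ?w 0 1 0 0)) (at s)"
    unfolding toda2_def N_def[symmetric]
    by (intro DERIV_add DERIV_cmult d)
  then show ?thesis
    unfolding z alg .
qed


section \<open>Derivatives and polynomials in them\<close>

lemma shift_0 [simp]: "shift i 0 x = x"
  by (simp add: shift_def)

lemma shift_That_0: "shift (That 0) s x = shift (T 0) (s / 2) x"
  by (simp add: shift_def)

lemma pd_eqI: "((\<lambda>s. f (shift i s x)) has_field_derivative d) (at 0) \<Longrightarrow> pd i f x = d"
  unfolding pd_def by (rule DERIV_imp_deriv)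

lemma pd_const [simp]: "pd i (\<lambda>_. c) x = 0"
  by (rule pd_eqI) simp

text \<open>L^-1 begins with p^-1 with coefficient 1. This reads off F_01 and F_11.\<close>

lemma neg_Lax_series_neg_1:
  fixes u w :: "'a::field"
  shows "neg_Lax_series u w c (- 1) = c 1"
proof -
  have "Lax_fls u w * (fls_X * fps_to_fls (inverse (1 + quad_fps u w))) =
      fls_X_inv * fls_X * fps_to_fls ((1 + quad_fps u w) * inverse (1 + quad_fps u w))"
    unfolding Lax_fls_eq fls_times_fps_to_fls by (simp only: mult_ac)
  also have "(1 + quad_fps u w) * inverse (1 + quad_fps u w) = 1"
    by (rule inverse_mult_eq_1') simp
  also have "fls_X_inv * fls_X * fps_to_fls 1 = (1 :: 'a fls)"
    by (simp add: fls_X_inv_times_conv_shift fls_X_conv_shift_1)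
  finally have "inverse (Lax_fls u w) = fls_X * fps_to_fls (inverse (1 + quad_fps u w))"
    by (rule inverse_unique)
  then have "Lax_pow u w (- 1) (- 1) = 1"
    by (simp add: Lax_pow_def power_int_minus fls_X_times_conv_shift del: fps_to_fls_plus)
  then show ?thesis
    by (simp add: neg_Lax_series_def)
qed

lemma log_quad_nth_1: "log_quad u w $ 1 = u"
  by (simp add: log_quad_def fps_compose_nth fps_ln_nth power2_eq_square)

text \<open>In degree -1 only the p^0 coefficient of \<open>B\<close> can meet the term u2 p^-1 of
  L, and p d/dp annihilates it in the first product of the bracket.\<close>

lemma poisson_Lax_neg_1:
  "poisson (\<lambda>y. nonneg_part (B y)) (\<lambda>y. Lax (u1 y) (u2 y)) x (- 1) = u2 x * pd (T 0) (\<lambda>y. B y 0) x"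
proof -
  let ?L = "\<lambda>y. Lax (u1 y) (u2 y)"
  have "times_series (p_dp (nonneg_part (B x))) (d_time (T 0) ?L x) (- 1) =
      (\<Sum>j\<in>{}. p_dp (nonneg_part (B x)) j * d_time (T 0) ?L x (- 1 - j))"
    by (rule times_series_eq_sum) (auto simp: p_dp_def nonneg_part_def d_time_def Lax_1)
  moreover have "times_series (d_time (T 0) (\<lambda>y. nonneg_part (B y)) x) (p_dp (?L x)) (- 1) =
      (\<Sum>j\<in>{0}. d_time (T 0) (\<lambda>y. nonneg_part (B y)) x j * p_dp (?L x) (- 1 - j))"
    by (rule times_series_eq_sum) (auto simp: p_dp_def nonneg_part_def d_time_def Lax_1)
  ultimately show ?thesis
    by (simp add: poisson_def p_dp_def nonneg_part_def d_time_def Lax_1 mult.commute)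
qed

section \<open>Polynomials in the second derivatives, with and without constant term\<close>

lemma spoly_zero: "(\<lambda>_. 0) \<in> second_deriv_polys F"
  using second_deriv_polys.scale[OF second_deriv_polys.deriv2, of 0] by simp

text \<open>Constant terms are allowed here: a product lacks a constant term once one factor does,
  and the cofactor need only lie in this set.\<close>

definition second_deriv_polys1 :: "('a::real_normed_field point \<Rightarrow> 'a) \<Rightarrow> ('a point \<Rightarrow> 'a) set" where
  "second_deriv_polys1 F = {\<lambda>x. c + A x | c A. A \<in> second_deriv_polys F}"

lemma spoly_imp_spoly1: "A \<in> second_deriv_polys F \<Longrightarrow> A \<in> second_deriv_polys1 F"
  unfolding second_deriv_polys1_def by (intro CollectI exI[of _ 0] exI[of _ A]) auto

lemma spoly1_const: "(\<lambda>_. c) \<in> second_deriv_polys1 F"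
  unfolding second_deriv_polys1_def using spoly_zero[of F] by (intro CollectI exI[of _ c] exI[of _ "\<lambda>_. 0"]) auto

lemma spoly1_add:
  assumes "A \<in> second_deriv_polys1 F" "B \<in> second_deriv_polys1 F"
  shows "(\<lambda>x. A x + B x) \<in> second_deriv_polys1 F"
proof -
  obtain c A' d B' where "A = (\<lambda>x. c + A' x)" "A' \<in> second_deriv_polys F"
      "B = (\<lambda>x. d + B' x)" "B' \<in> second_deriv_polys F"
    using assms unfolding second_deriv_polys1_def by blast
  then show ?thesis
    unfolding second_deriv_polys1_def
    by (intro CollectI exI[of _ "c + d"] exI[of _ "\<lambda>x. A' x + B' x"])
      (auto intro: second_deriv_polys.add)
qed

lemma spoly_mult_spoly1:
  assumes "A \<in> second_deriv_polys F" "B \<in> second_deriv_polys1 F"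
  shows "(\<lambda>x. A x * B x) \<in> second_deriv_polys F"
proof -
  obtain d B' where B: "B = (\<lambda>x. d + B' x)" "B' \<in> second_deriv_polys F"
    using assms unfolding second_deriv_polys1_def by blast
  have "(\<lambda>x. d * A x + A x * B' x) \<in> second_deriv_polys F"
    using assms B by (intro second_deriv_polys.intros)
  then show ?thesis by (simp add: B algebra_simps)
qed

lemma spoly1_mult_spoly:
  "A \<in> second_deriv_polys1 F \<Longrightarrow> B \<in> second_deriv_polys F \<Longrightarrow> (\<lambda>x. A x * B x) \<in> second_deriv_polys F"
  using spoly_mult_spoly1[of B F A] by (simp add: mult.commute)

lemma spoly1_mult:
  assumes "A \<in> second_deriv_polys1 F" "B \<in> second_deriv_polys1 F"
  shows "(\<lambda>x. A x * B x) \<in> second_deriv_polys1 F"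
proof -
  obtain c A' where A: "A = (\<lambda>x. c + A' x)" "A' \<in> second_deriv_polys F"
    using assms unfolding second_deriv_polys1_def by blast
  obtain d B' where B: "B = (\<lambda>x. d + B' x)" "B' \<in> second_deriv_polys F"
    using assms unfolding second_deriv_polys1_def by blast
  have "(\<lambda>x. c * B' x + A' x * B x) \<in> second_deriv_polys F"
    using assms A B by (intro second_deriv_polys.add second_deriv_polys.scale spoly_mult_spoly1)
  then show ?thesis
    unfolding second_deriv_polys1_def A B
    by (intro CollectI exI[of _ "c * d"] exI[of _ "\<lambda>x. c * B' x + A' x * (d + B' x)"])
      (auto simp: algebra_simps B)
qed

lemma spoly1_power: "A \<in> second_deriv_polys1 F \<Longrightarrow> (\<lambda>x. A x ^ n) \<in> second_deriv_polys1 F"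
  by (induction n) (auto intro: spoly1_const spoly1_mult)

lemma spoly1_sum:
  "(\<And>j. j \<in> I \<Longrightarrow> A j \<in> second_deriv_polys1 F) \<Longrightarrow> (\<lambda>x. \<Sum>j\<in>I. A j x) \<in> second_deriv_polys1 F"
  by (induction I rule: infinite_finite_induct) (auto intro: spoly1_const spoly1_add)

lemma spoly_sum:
  "(\<And>j. j \<in> I \<Longrightarrow> A j \<in> second_deriv_polys F) \<Longrightarrow> (\<lambda>x. \<Sum>j\<in>I. A j x) \<in> second_deriv_polys F"
  by (induction I rule: infinite_finite_induct) (auto intro: spoly_zero second_deriv_polys.add)

lemmas spoly1_intros = spoly1_const spoly1_add spoly1_mult spoly1_power spoly1_sum

context
  fixes F U W V :: "'a::real_normed_field point \<Rightarrow> 'a"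
  assumes U: "U \<in> second_deriv_polys F" and W: "W \<in> second_deriv_polys F" and V: "V \<in> second_deriv_polys F"
begin

lemma tsum_spoly1: "(\<lambda>x. tsum n a (U x) (W x)) \<in> second_deriv_polys1 F"
  unfolding tsum_def using U W by (intro spoly1_intros spoly_imp_spoly1)

text \<open>A constant monomial occurs only for n = j = 0, with coefficient \<open>a 0\<close>. The
  variable w counts as a generator, being F_11 in the application.\<close>

lemma tsum_spoly:
  assumes "n > 0 \<or> a 0 = 0"
  shows "(\<lambda>x. tsum n a (U x) (W x)) \<in> second_deriv_polys F"
  unfolding tsum_def
proof (rule spoly_sum)
  fix j
  consider "n < 2 * j" | "j > 0" | "j = 0" "n > 0" | "j = 0" "n = 0" "a 0 = 0"
    using assms by blast
  then show "(\<lambda>x. of_nat (trinom n j) * a j * U x ^ (n - 2 * j) * W x ^ j) \<in> second_deriv_polys F"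
  proof cases
    case 1
    then show ?thesis by (simp add: trinom_eq_0' spoly_zero)
  next
    case 2
    then obtain i where j: "j = Suc i"
      by (cases j) auto
    have "(\<lambda>x. (of_nat (trinom n j) * a j * U x ^ (n - 2 * j) * W x ^ i) * W x) \<in> second_deriv_polys F"
      using U W by (intro spoly1_mult_spoly spoly1_intros spoly_imp_spoly1)
    then show ?thesis by (simp add: j mult_ac)
  next
    case 3
    then obtain i where n: "n = Suc i"
      by (cases n) auto
    have "(\<lambda>x. (of_nat (trinom n j) * a j * U x ^ i) * U x) \<in> second_deriv_polys F"
      using U W by (intro spoly1_mult_spoly spoly1_intros spoly_imp_spoly1)
    then show ?thesis using 3 by (simp add: n mult_ac)
  next
    case 4
    then show ?thesis by (simp add: spoly_zero)
  qed
qed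

lemma toda_spoly1: "(\<lambda>x. toda c e n (U x) (W x) (V x)) \<in> second_deriv_polys1 F"
  unfolding toda_eq using V by (intro spoly1_intros spoly_imp_spoly1 tsum_spoly1)

lemma toda_spoly: "(\<lambda>x. toda c 0 n (U x) (W x) (V x)) \<in> second_deriv_polys F"
  unfolding toda_eq using V
  by (intro second_deriv_polys.add spoly_mult_spoly1[where A = "\<lambda>x. c / 2 * V x"] second_deriv_polys.scale
      tsum_spoly1 tsum_spoly) (simp_all add: harm_def)

lemma toda_v_spoly1: "(\<lambda>x. toda_v c e n (U x) (W x) (V x)) \<in> second_deriv_polys1 F"
  unfolding toda_v_eq using V by (intro spoly1_intros spoly_imp_spoly1 tsum_spoly1)

text \<open>For n = 0 the function is the constant c / 2, so n > 0 is essential.\<close>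

lemma toda_v_spoly: "n > 0 \<Longrightarrow> (\<lambda>x. toda_v c e n (U x) (W x) (V x)) \<in> second_deriv_polys F"
  unfolding toda_v_eq using V
  by (intro second_deriv_polys.add spoly_mult_spoly1[where A = "\<lambda>x. c / 2 * V x"] second_deriv_polys.scale
      tsum_spoly1 tsum_spoly) (simp_all add: harm_def)

text \<open>Every summand has a factor u, w or \<open>toda_v c e n\<close>, each without constant
  term.\<close>

lemma pair_E_spoly:
  assumes "n > 0"
  shows "(\<lambda>x. pair_E c e n c' e' m (U x) (W x) (V x)) \<in> second_deriv_polys F"
  unfolding pair_E_def pair_u_def pair_v_def using U W assms
  by (intro second_deriv_polys.add second_deriv_polys.scale spoly_mult_spoly1 toda_v_spoly
      spoly1_intros toda_spoly1 toda_v_spoly1)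

lemma toda2_spoly:
  assumes "n > 0"
  shows "(\<lambda>x. toda2 n m (U x) (W x) (V x)) \<in> second_deriv_polys F"
  unfolding toda2_def using assms
  by (intro second_deriv_polys.add second_deriv_polys.scale pair_E_spoly)

end


section \<open>The free energy\<close>

locale ext_dToda_free_energy =
  fixes D :: "'a::{real_normed_field,banach} point set"
    and lu u1 u2 F :: "'a point \<Rightarrow> 'a"
  assumes domain: "time_domain D"
    and hierarchy: "ext_dToda D lu u1 u2"
    and energy: "free_energy D lu u1 u2 F"
    and no_constants: "no_integration_constants D F"
begin

text \<open>Second derivatives of F replace \<open>u1\<close>, \<open>u2\<close> and
  \<open>lu\<close>, with which they agree on \<open>D\<close>, so that expressions in them are
  literally members of \<open>second_deriv_polys F\<close>.\<close>

abbreviation U :: "'a point \<Rightarrow> 'a" where "U \<equiv> pd (T 0) (pd (T (Suc 0)) F)"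
abbreviation W :: "'a point \<Rightarrow> 'a" where "W \<equiv> pd (T (Suc 0)) (pd (T (Suc 0)) F)"
abbreviation V :: "'a point \<Rightarrow> 'a" where "V \<equiv> pd (T 0) (pd (T 0) F)"

lemma UWV_spoly: "U \<in> second_deriv_polys F" "W \<in> second_deriv_polys F" "V \<in> second_deriv_polys F"
  by (rule second_deriv_polys.deriv2)+

lemma pds_has_derivative:
  "x \<in> D \<Longrightarrow> ((\<lambda>s. pds is F (shift i s x)) has_field_derivative pd i (pds is F) x) (at 0)"
  using energy unfolding free_energy_def smooth_fun_def pd_def DERIV_deriv_iff_field_differentiable
  by blast

lemma pds_swap: "x \<in> D \<Longrightarrow> pd i (pd j (pds is F)) x = pd j (pd i (pds is F)) x"
  using energy unfolding free_energy_def smooth_fun_def by blast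

text \<open>The coordinate line through x stays in \<open>D\<close> near x, so agreement on
  \<open>D\<close> suffices.\<close>

lemma pd_cong:
  assumes "x \<in> D" "\<And>y. y \<in> D \<Longrightarrow> f y = g y"
  shows "pd i f x = pd i g x"
proof -
  have "\<forall>\<^sub>F s in nhds 0. shift i s x \<in> D"
    using domain assms(1) unfolding time_domain_def by blast
  then show ?thesis
    unfolding pd_def by (intro deriv_cong_ev refl) (auto elim: eventually_mono simp: assms(2))
qed

lemma pd2_swap: "x \<in> D \<Longrightarrow> pd i (pd j F) x = pd j (pd i F) x"
  using pds_swap[of x i j "[]"] by simp

lemma pd3_swap: "x \<in> D \<Longrightarrow> pd i (pd j (pd k F)) x = pd j (pd i (pd k F)) x"
  using pds_swap[of x i j "[k]"] by simp

lemma pd3_swap_inner: "x \<in> D \<Longrightarrow> pd i (pd j (pd k F)) x = pd i (pd k (pd j F)) x"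
  by (intro pd_cong pd2_swap)

lemma pd2_has_derivative:
  "x \<in> D \<Longrightarrow> ((\<lambda>s. pd j (pd k F) (shift i s x)) has_field_derivative pd i (pd j (pd k F)) x) (at 0)"
  using pds_has_derivative[of x "[j, k]" i] by simp

lemma pd_That_0: 
  assumes "x \<in> D"
  shows "pd (That 0) (pd i F) x = pd (T 0) (pd i F) x / 2"
proof (rule pd_eqI)
  have "((\<lambda>s. pd i F (shift (T 0) s x)) has_field_derivative pd (T 0) (pd i F) x) (at (0 / 2))"
    using pds_has_derivative[OF assms, of "[i]" "T 0"] by simp
  moreover have "((\<lambda>s. s / 2) has_field_derivative 1 / 2) (at (0 :: 'a))"
    by (auto intro!: derivative_eq_intros)
  ultimately show "((\<lambda>s. pd i F (shift (That 0) s x)) has_field_derivative pd (T 0) (pd i F) x / 2) (at 0)"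
    unfolding shift_That_0 using DERIV_chain2 by fastforce
qed

lemma V_eq: "x \<in> D \<Longrightarrow> V x = lu x"
  using energy unfolding free_energy_def by blast

lemma U_eq: 
  assumes "x \<in> D"
  shows "U x = u1 x"
proof -
  have "\<forall>x\<in>D. in_p_inv (log_quad (u1 x) (u2 x)) =
      neg_Lax_series (u1 x) (u2 x) (\<lambda>m. pd (T 0) (pd (T m) F) x / of_nat m)"
    using energy unfolding free_energy_def by (elim conjE)
  from fun_cong[OF bspec[OF this assms], of "- 1"] show ?thesis
    by (simp add: neg_Lax_series_neg_1 in_p_inv_def log_quad_nth_1[simplified])
qed

lemma W_eq: 
  assumes "x \<in> D"
  shows "W x = u2 x"
proof -
  have "\<forall>n\<ge>1. \<forall>x\<in>D. neg_part (Lax_pow (u1 x) (u2 x) (int n)) =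
      neg_Lax_series (u1 x) (u2 x) (\<lambda>m. pd (T n) (pd (T m) F) x / of_nat m)"
    using energy unfolding free_energy_def by (elim conjE)
  from fun_cong[OF this[rule_format, of 1 x, OF order_refl assms], of "- 1"] show ?thesis
    by (simp add: neg_Lax_series_neg_1 neg_part_def Lax_1)
qed

lemma W_exp: "x \<in> D \<Longrightarrow> W x = exp (V x)"
  using hierarchy unfolding ext_dToda_def by (simp add: W_eq V_eq)

lemma W_nonzero: "x \<in> D \<Longrightarrow> W x \<noteq> 0"
  by (simp add: W_exp)

lemma pd_W: 
  assumes "x \<in> D"
  shows "pd i W x = W x * pd i V x"
proof -
  have "pd i W x = pd i (\<lambda>y. exp (V y)) x"
    using assms by (rule pd_cong) (rule W_exp)
  also have "\<dots> = exp (V x) * pd i V x"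
    by (rule pd_eqI) (use DERIV_chain2[OF DERIV_exp pd2_has_derivative[OF assms]] in simp)
  finally show ?thesis by (simp add: W_exp assms)
qed

lemma UWV_has_derivative:
  assumes "x \<in> D"
  shows "((\<lambda>s. U (shift i s x)) has_field_derivative pd i U x) (at 0)"
    and "((\<lambda>s. W (shift i s x)) has_field_derivative W (shift i 0 x) * pd i V x) (at 0)"
    and "((\<lambda>s. V (shift i s x)) has_field_derivative pd i V x) (at 0)"
  using pd2_has_derivative[OF assms, of "T 0" "T (Suc 0)" i] pd2_has_derivative[OF assms, of "T (Suc 0)" "T (Suc 0)" i]
    pd2_has_derivative[OF assms, of "T 0" "T 0" i]
  by (simp_all add: pd_W[OF assms, simplified])

section \<open>Hatted flows and two-point functions\<close>

abbreviation hat :: "nat \<Rightarrow> 'a point \<Rightarrow> 'a" where "hat n \<equiv> \<lambda>y. toda 1 0 n (U y) (W y) (V y)"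
abbreviation hat_v :: "nat \<Rightarrow> 'a point \<Rightarrow> 'a" where "hat_v n \<equiv> \<lambda>y. toda_v 1 0 n (U y) (W y) (V y)"

lemma pd_hat:
  assumes "x \<in> D"
  shows "pd i (hat n) x = of_nat n * hat (n - 1) x * pd i U x + hat_v n x * pd i V x"
  by (rule pd_eqI, rule DERIV_cong, rule toda_has_derivative[OF UWV_has_derivative[OF assms]]) simp

lemma Lax_log_pow_eq_hat: 
  "x \<in> D \<Longrightarrow> Lax_log_pow (lu x) (u1 x) (u2 x) n 0 = hat n x"
  using W_nonzero[of x] by (simp add: W_eq U_eq V_eq Lax_log_pow_nth_0 toda_eq
      tsum_diff[of n "\<lambda>_. 0" harm, simplified])

lemma pd_That_V:
  assumes x: "x \<in> D"
  shows "pd (That n) V x = pd (T 0) (hat n) x"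
proof -
  have "d_time (That n) (\<lambda>y. Lax (u1 y) (u2 y)) x (- 1) =
      poisson (\<lambda>y. nonneg_part (Lax_log_pow (lu y) (u1 y) (u2 y) n)) (\<lambda>y. Lax (u1 y) (u2 y)) x (- 1)"
    using hierarchy x unfolding ext_dToda_def by simp
  then have "pd (That n) u2 x = u2 x * pd (T 0) (\<lambda>y. Lax_log_pow (lu y) (u1 y) (u2 y) n 0) x"
    by (simp add: poisson_Lax_neg_1 d_time_def Lax_1)
  also have "pd (That n) u2 x = pd (That n) W x"
    using x by (rule pd_cong) (simp add: W_eq)
  also have "pd (T 0) (\<lambda>y. Lax_log_pow (lu y) (u1 y) (u2 y) n 0) x = pd (T 0) (hat n) x"
    using x by (rule pd_cong) (rule Lax_log_pow_eq_hat)
  finally show ?thesis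
    using W_nonzero[OF x] by (simp add: pd_W x W_eq[symmetric])
qed

lemma no_constantsD:
  "A \<in> second_deriv_polys F \<Longrightarrow> B \<in> second_deriv_polys F \<Longrightarrow>
   (\<And>y. y \<in> D \<Longrightarrow> pd (T 0) A y = pd (T 0) B y) \<Longrightarrow> x \<in> D \<Longrightarrow> A x = B x"
  using no_constants unfolding no_integration_constants_def by blast

text \<open>By \<open>pd_That_V\<close> both sides have the same derivative in \<open>T 0\<close>,
  and the integration convention applies because P_n has no constant term.\<close>

lemma F_That_0: 
  assumes "x \<in> D"
  shows "pd (That n) (pd (T 0) F) x = hat n x"
proof (rule no_constantsD[OF _ _ _ assms])
  show "pd (That n) (pd (T 0) F) \<in> second_deriv_polys F"
    by (rule second_deriv_polys.deriv2)
  show "hat n \<in> second_deriv_polys F"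
    by (rule toda_spoly[OF UWV_spoly])
  fix y assume "y \<in> D"
  then show "pd (T 0) (pd (That n) (pd (T 0) F)) y = pd (T 0) (hat n) y"
    by (simp add: pd3_swap[of y "T 0"] pd_That_V)
qed

text \<open>
  The flow of \<open>u\<^sub>1\<close> is read off from the symmetry of the third derivative \<open>F\<^bsub>0,1,n^\<^esub>\<close>, so that no further
  coefficient of the Lax equation is needed.
\<close>

lemma pd_That_U:
  assumes x: "x \<in> D"
  shows "pd (That n) U x = of_nat n * hat (n - 1) x * (W x * pd (T 0) V x) + hat_v n x * pd (T 0) U x"
proof -
  have "pd (That n) U x = pd (That n) (pd (T (Suc 0)) (pd (T 0) F)) x"
    by (rule pd3_swap_inner[OF x])
  also have "\<dots> = pd (T (Suc 0)) (pd (That n) (pd (T 0) F)) x"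
    by (rule pd3_swap[OF x])
  also have "\<dots> = pd (T (Suc 0)) (hat n) x"
    using x by (rule pd_cong) (rule F_That_0)
  also have "\<dots> = of_nat n * hat (n - 1) x * pd (T (Suc 0)) U x + hat_v n x * pd (T (Suc 0)) V x"
    by (rule pd_hat[OF x])
  also have "pd (T (Suc 0)) U x = W x * pd (T 0) V x"
    unfolding pd_W[OF x, symmetric] by (rule pd3_swap[OF x])
  also have "pd (T (Suc 0)) V x = pd (T 0) U x"
    unfolding pd3_swap[OF x, of "T (Suc 0)"] by (rule pd3_swap_inner[OF x])
  finally show ?thesis .
qed

text \<open>Reordering the derivatives gives the flow of P_m along \<open>That n\<close>; inserting
  the flows of u and v produces the form evaluated on their \<open>T 0\<close> derivatives.\<close>

lemma pd_0_F_That_That: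
  assumes x: "x \<in> D"
  shows "pd (T 0) (pd (That n) (pd (That m) F)) x =
    pair_u 1 0 n 1 0 m (U x) (W x) (V x) * pd (T 0) U x + pair_v 1 0 n 1 0 m (U x) (W x) (V x) * pd (T 0) V x"
proof -
  have "pd (T 0) (pd (That n) (pd (That m) F)) x = pd (That n) (pd (T 0) (pd (That m) F)) x"
    by (rule pd3_swap[OF x])
  also have "\<dots> = pd (That n) (pd (That m) (pd (T 0) F)) x"
    by (rule pd3_swap_inner[OF x])
  also have "\<dots> = pd (That n) (hat m) x"
    using x by (rule pd_cong) (rule F_That_0)
  also have "\<dots> = of_nat m * hat (m - 1) x * pd (That n) U x + hat_v m x * pd (That n) V x"
    by (rule pd_hat[OF x])
  finally show ?thesis
    unfolding pd_That_U[OF x] pd_That_V[OF x] pd_hat[OF x] pair_u_def pair_v_def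
    by (simp add: algebra_simps)
qed

lemma F_That_That:
  assumes x: "x \<in> D" and n: "n > 0"
  shows "pd (That n) (pd (That m) F) x = toda2 n m (U x) (W x) (V x)"
proof (rule no_constantsD[OF _ _ _ x])
  show "pd (That n) (pd (That m) F) \<in> second_deriv_polys F"
    by (rule second_deriv_polys.deriv2)
  show "(\<lambda>x. toda2 n m (U x) (W x) (V x)) \<in> second_deriv_polys F"
    by (rule toda2_spoly[OF UWV_spoly n])
  fix y assume y: "y \<in> D"
  have "n + m > 0"
    using n by simp
  then have "pd (T 0) (\<lambda>x. toda2 n m (U x) (W x) (V x)) y =
    pair_u 1 0 n 1 0 m (U y) (W y) (V y) * pd (T 0) U y + pair_v 1 0 n 1 0 m (U y) (W y) (V y) * pd (T 0) V y"
    by (intro pd_eqI, rule DERIV_cong[OF toda2_has_derivative[OF _ UWV_has_derivative[OF y]]]) simp_all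
  then show "pd (T 0) (pd (That n) (pd (That m) F)) y = pd (T 0) (\<lambda>x. toda2 n m (U x) (W x) (V x)) y"
    by (simp only: pd_0_F_That_That[OF y])
qed

text \<open>A direct consequence of the relation between \<open>That 0\<close> and
  \<open>T 0\<close>. It includes n = 0, where \<open>toda2 0 0\<close> would divide by 0.\<close>

lemma F_That_That_0:
  assumes x: "x \<in> D"
  shows "pd (That n) (pd (That 0) F) x = hat n x / 2"
proof -
  have "pd (That n) (pd (That 0) F) x = pd (That 0) (pd (That n) F) x"
    by (rule pd2_swap[OF x])
  also have "\<dots> = pd (T 0) (pd (That n) F) x / 2"
    by (rule pd_That_0[OF x])
  also have "pd (T 0) (pd (That n) F) x = pd (That n) (pd (T 0) F) x"
    by (rule pd2_swap[OF x])
  also have "\<dots> = hat n x"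
    by (rule F_That_0[OF x])
  finally show ?thesis .
qed

end

section \<open>Evaluation at u1 = 0, u2 = 1\<close>

lemma toda_at_0_1: "toda c e n 0 1 0 =
    (if even n then of_nat (n choose (n div 2)) * (e - c * harm (n div 2)) else 0)"
  by (simp add: toda_def tsum_at_0_1)

lemma toda_v_at_0_1: "toda_v c e n 0 1 0 =
    (if even n then of_nat (n choose (n div 2)) * (of_nat (n div 2) * (e - c * harm (n div 2)) + c / 2) else 0)"
  by (simp add: toda_v_def tsum_at_0_1)

lemma of_nat_central_binomial: "of_nat ((2 * k) choose k) = of_nat (k + 1) * (catalan k :: 'a::field_char_0)"
  by (simp add: catalan_def del: of_nat_Suc of_nat_add)

text \<open>At u = 0 only \<open>pair_v\<close> remains, and \<open>toda\<close> and
  \<open>toda_v\<close> vanish at odd index. Each product has such a factor, or the factor 0 from an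
  index 0.\<close>

lemma toda2_at_0_1_parity: "odd (n + m) \<Longrightarrow> toda2 n m 0 1 0 = 0"
  by (cases "even n") (auto simp: toda2_def pair_E_def pair_u_def pair_v_def toda_at_0_1 toda_v_at_0_1 elim: oddE)

lemma toda2_at_0_1_odd:
  "toda2 (2 * k + 1) (2 * l + 1) 0 1 0 =
       of_nat ((2 * l + 1) * (2 * k + 1) * (l + 1) * (k + 1)) / of_nat (l + k + 1) *
       ((harm k + 1 / (2 * of_nat (l + k + 1))) * (harm l + 1 / (2 * of_nat (l + k + 1)))
         + 1 / (4 * of_nat (k + l + 1) ^ 2)) * catalan k * (catalan l :: 'a::real_normed_field)"
proof -
  define N :: 'a where "N = of_nat (l + k + 1)"
  \<comment> \<open>The u-derivative of Q at index \<open>2 * k + 1\<close>; for odd indices only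
    the product of the u-derivatives survives.\<close>
  define b where "b = of_nat (2 * k + 1) * (of_nat (k + 1) * (catalan k :: 'a))"
  define b' where "b' = of_nat (2 * l + 1) * (of_nat (l + 1) * (catalan l :: 'a))"
  have N: "N \<noteq> 0"
    unfolding N_def by (simp only: of_nat_eq_0_iff)
  have p: "pair_E c e (2 * k + 1) c' e' (2 * l + 1) 0 1 0 =
      2 * (b * (e - c * harm k) * (b' * (e' - c' * harm l)))" for c e c' e' :: 'a
    by (simp add: pair_E_def pair_v_def toda_at_0_1 toda_v_at_0_1 of_nat_central_binomial b_def b'_def
        del: of_nat_Suc of_nat_add)
  have s: "of_nat (2 * k + 1 + (2 * l + 1)) = 2 * N" "k + l + 1 = l + k + 1"
    by (simp_all add: N_def)
  have "toda2 (2 * k + 1) (2 * l + 1) 0 1 0 =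
      b * b' / N * ((harm k + 1 / (2 * N)) * (harm l + 1 / (2 * N)) + 1 / (4 * N ^ 2))"
    unfolding toda2_def p s using N by (simp add: field_simps power2_eq_square power3_eq_cube)
  also have "b * b' = of_nat ((2 * l + 1) * (2 * k + 1) * (l + 1) * (k + 1)) * catalan k * catalan l"
    unfolding b_def b'_def by (simp only: of_nat_mult mult_ac)
  finally show ?thesis
    unfolding s N_def[symmetric] by simp
qed

lemma toda2_at_0_1_even:
  assumes "k \<ge> 1" "l \<ge> 1"
  shows "toda2 (2 * k) (2 * l) 0 1 0 =
       of_nat (l * k * (l + 1) * (k + 1)) / of_nat (l + k) *
       ((harm k - of_nat l / (2 * of_nat k * of_nat (l + k)))
          * (harm l - of_nat k / (2 * of_nat l * of_nat (l + k)))
         + 1 / (4 * of_nat (k + l) ^ 2)) * catalan k * (catalan l :: 'a::real_normed_field)"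
proof -
  define K L where "K = (of_nat k :: 'a)" and "L = (of_nat l :: 'a)"
  define b where "b = of_nat (k + 1) * (catalan k :: 'a)"
  define b' where "b' = of_nat (l + 1) * (catalan l :: 'a)"
  have "L + K = of_nat (l + k)"
    by (simp add: K_def L_def)
  with assms have N: "L + K \<noteq> 0" "K \<noteq> 0" "L \<noteq> 0"
    by (simp_all only: K_def L_def of_nat_eq_0_iff)
  have p: "pair_E c e (2 * k) c' e' (2 * l) 0 1 0 =
      2 * (b * (K * (e - c * harm k) + c / 2) * (b' * (L * (e' - c' * harm l) + c' / 2)))" for c e c' e' :: 'a
    using assms
    by (simp add: pair_E_def pair_v_def toda_at_0_1 toda_v_at_0_1 of_nat_central_binomial b_def b'_def K_def L_def
        del: of_nat_Suc of_nat_add)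
  have s: "of_nat (2 * k + 2 * l) = 2 * (L + K)" "of_nat (k + l) = L + K" "of_nat (l + k) = L + K"
    by (simp_all add: K_def L_def)
  define d d' where "d = (harm k :: 'a)" and "d' = (harm l :: 'a)"
  define M where "M = L + K"
  \<comment> \<open>For even indices only the v-derivatives survive: \<open>b * a\<close> is that of
    P and \<open>b * K\<close> that of Q at index \<open>2 * k\<close>, and similarly for
    \<open>2 * l\<close>.\<close>
  define a a' where "a = 1 / 2 - K * d" and "a' = 1 / 2 - L * d'"
  have M: "M \<noteq> 0" and LM: "L = M - K" and KM: "K = M - L"
    using N by (simp_all add: M_def)
  \<comment> \<open>Eliminating \<open>L\<close> through M = L + K turns the bracket of the claim
    into an expression linear in \<open>a\<close>.\<close>
  have a: "d - L / (2 * K * M) = (K / (2 * M) - a) / K"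
    using N M unfolding LM a_def by (simp add: field_simps)
  have a': "d' - K / (2 * L * M) = (L / (2 * M) - a') / L"
    using N M unfolding KM a'_def by (simp add: field_simps)
  have "toda2 (2 * k) (2 * l) 0 1 0 =
      b * b' * (2 * a * a' / (2 * M) - (2 * a * L + 2 * K * a') / (2 * M) ^ 2 + 4 * K * L / (2 * M) ^ 3)"
    unfolding toda2_def p s a_def a'_def d_def d'_def M_def
    by (simp add: algebra_simps diff_divide_distrib add_divide_distrib)
  also have "2 * a * a' / (2 * M) - (2 * a * L + 2 * K * a') / (2 * M) ^ 2 + 4 * K * L / (2 * M) ^ 3 =
      L * K / M * ((d - L / (2 * K * M)) * (d' - K / (2 * L * M)) + 1 / (4 * M ^ 2))"
    unfolding a a' using N M by (simp add: field_simps power2_eq_square power3_eq_cube)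
  finally have "toda2 (2 * k) (2 * l) 0 1 0 = b * b' *
    (L * K / (L + K) * ((harm k - L / (2 * K * (L + K))) * (harm l - K / (2 * L * (L + K))) + 1 / (4 * (L + K) ^ 2)))"
    unfolding d_def d'_def M_def .
  moreover have "of_nat (l * k * (l + 1) * (k + 1)) * catalan k * catalan l = L * K * (b * b')"
    unfolding b_def b'_def K_def L_def by (simp only: of_nat_mult mult_ac)
  ultimately show ?thesis
    unfolding s K_def[symmetric] L_def[symmetric] by (simp add: mult_ac)
qed

theorem theorem10:
  fixes D :: "'a::{real_normed_field,banach} point set"
    and lu u1 u2 F :: "'a point \<Rightarrow> 'a"
    and x :: "'a point"
    and Fhh :: "nat \<Rightarrow> nat \<Rightarrow> 'a"
  assumes "time_domain D"
    and "ext_dToda D lu u1 u2"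
    and "free_energy D lu u1 u2 F"
    and "no_integration_constants D F"
    and "x \<in> D"
    and "pd (T 0) (pd (T 0) F) x = 0"
    and "pd (T 0) (pd (T 1) F) x = 0"
  defines "Fhh \<equiv> \<lambda>n m. pd (That n) (pd (That m) F) x"
  shows "(\<forall>n m. Fhh n m = Fhh m n) \<and>
    (\<forall>k\<ge>1. Fhh (2 * k) 0 = - (of_nat (k + 1) / 2) * harm k * catalan k) \<and>
    (\<forall>k l. Fhh (2 * k + 1) (2 * l + 1) =
       of_nat ((2 * l + 1) * (2 * k + 1) * (l + 1) * (k + 1)) / of_nat (l + k + 1) *
       ((harm k + 1 / (2 * of_nat (l + k + 1))) * (harm l + 1 / (2 * of_nat (l + k + 1)))
         + 1 / (4 * of_nat (k + l + 1) ^ 2)) * catalan k * catalan l) \<and>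
    (\<forall>k\<ge>1. \<forall>l\<ge>1. Fhh (2 * k) (2 * l) =
       of_nat (l * k * (l + 1) * (k + 1)) / of_nat (l + k) *
       ((harm k - of_nat l / (2 * of_nat k * of_nat (l + k)))
          * (harm l - of_nat k / (2 * of_nat l * of_nat (l + k)))
         + 1 / (4 * of_nat (k + l) ^ 2)) * catalan k * catalan l) \<and>
    (\<forall>n m.
       \<not> (\<exists>k\<ge>1. (n = 2 * k \<and> m = 0) \<or> (n = 0 \<and> m = 2 * k)) \<and>
       \<not> (\<exists>k l. n = 2 * k + 1 \<and> m = 2 * l + 1) \<and>
       \<not> (\<exists>k\<ge>1. \<exists>l\<ge>1. n = 2 * k \<and> m = 2 * l)
       \<longrightarrow> Fhh n m = 0)"
proof -
  interpret ext_dToda_free_energy D lu u1 u2 F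
    using assms(1-4) by unfold_locales
  note x = \<open>x \<in> D\<close>
  have U: "U x = 0" and V: "V x = 0"
    using assms(6,7) by simp_all
  have W: "W x = 1"
    unfolding W_exp[OF x] V by simp
  have sym: "Fhh n m = Fhh m n" for n m
    unfolding Fhh_def by (rule pd2_swap[OF x])
  have pos: "Fhh n m = toda2 n m 0 1 0" if "n > 0" for n m
    unfolding Fhh_def F_That_That[OF x that] U V W ..
  have zero: "Fhh n 0 = toda 1 0 n 0 1 0 / 2" for n
    unfolding Fhh_def F_That_That_0[OF x] U V W ..
  have even_zero: "Fhh (2 * k) 0 = - (of_nat (k + 1) / 2) * harm k * catalan k" for k
    unfolding zero toda_at_0_1 by (simp add: of_nat_central_binomial del: of_nat_Suc of_nat_add)
  have "Fhh n m = 0"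
    if "\<not> (\<exists>k\<ge>1. (n = 2 * k \<and> m = 0) \<or> (n = 0 \<and> m = 2 * k))"
      and "\<not> (\<exists>k l. n = 2 * k + 1 \<and> m = 2 * l + 1)"
      and "\<not> (\<exists>k\<ge>1. \<exists>l\<ge>1. n = 2 * k \<and> m = 2 * l)" for n m
  proof (cases "odd (n + m)")
    case True
    show ?thesis
    proof (cases "n > 0")
      case False
      then have "m > 0" using True by (auto intro: Nat.gr0I)
      then show ?thesis
        unfolding sym[of n m] by (subst pos) (use True in \<open>simp_all add: toda2_at_0_1_parity add.commute\<close>)
    qed (use True in \<open>simp add: pos toda2_at_0_1_parity\<close>)
  next
    case False
    \<comment> \<open>Equal parity leaves only the origin outside the listed families; there the
      value is a multiple of \<open>harm 0\<close> = 0.\<close>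
    have "n = 0 \<and> m = 0"
    proof (cases "even n")
      case True
      with False obtain k l where "n = 2 * k" "m = 2 * l"
        by (auto elim!: evenE)
      with that show ?thesis by (cases "k \<ge> 1"; cases "l \<ge> 1") auto
    next
      case odd: False
      with False obtain k l where "n = 2 * k + 1" "m = 2 * l + 1"
        by (metis even_add oddE)
      with that show ?thesis by blast
    qed
    then show ?thesis
      using even_zero[of 0] by (simp add: harm_def)
  qed
  then show ?thesis
    using sym even_zero by (auto simp del: of_nat_Suc of_nat_add of_nat_mult
        simp: pos toda2_at_0_1_odd[simplified Suc_eq_plus1[symmetric]] toda2_at_0_1_even)
qed

end
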